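(* Assume the following. (1) For $\mu$-a.e. $s\in E$, the operator $A(s,\cdot)$ is maximal monotone; and for every $\lambda>0$ and $x\in\mathcal H$, the map $s\mapsto J_\lambda(s,x)$ is $\mathcal E/\mathcal B(\mathcal H)$-measurable. (2) $(\lambda_n)_{n\in\mathbb N}$ is a sequence of positive reals with $\sum_n\lambda_n=+\infty$ and $\sum_n\lambda_n^2<\infty$; the random variables $(\xi_n)_{n\ge1}$ are independent and identically distributed with distribution $\mu$. (3) The monotone operator $\underline A$ is maximal. (4) $\mathrm{zer}(\underline A)\neq\emptyset$ and $\mathrm{zer}(\underline A)\subset \mathcal Z_A(2)$. (5) For every bounded set $K\subset\mathcal H$, the family of functions $(\|A_0(\cdot,x)\|: x\in K\cap\mathcal D)$ is uniformly integrable with respect to $\mu$. Assume moreover that the domains $D_s$ coincide for all $s$ outside a $\mu$-negligible set. Let $x_0\in\mathcal H$ be fixed and let $(x_n)$ be the random sequence defined by $x_{n+1}=J_{\lambda_n}(\xi_{n+1},x_n)$, $n\in\mathbb N$, with weighted averages $\overline x_n=\sum_{k=1}^n\lambda_kx_k/\sum_{k=1}^n\lambda_k$. Then, almost surely, $(\overline x_n)$ converges weakly to a zero of $\underline A$.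
   Context: $(E,\mathcal E,\mu)$ is a complete probability space, $\mathcal H$ is a separable Hilbert space with Borel $\sigma$-algebra $\mathcal B(\mathcal H)$, $A:E\times\mathcal H\to2^{\mathcal H}$ is a set-valued mapping, $(\Omega,\mathcal F,\mathbb P)$ is a probability space and $\xi_n:\Omega\to E$ ($n\ge1$) are random variables. For $\lambda>0$, $J_\lambda(s,x)=(I+\lambda A(s,\cdot))^{-1}(x)$ is the resolvent (single-valued and defined on all of $\mathcal H$ whenever $A(s,\cdot)$ is maximal monotone). $D_s=\mathrm{dom}(A(s,\cdot))=\{x: A(s,x)\ne\emptyset\}$. The essential intersection $\mathcal D$ of the domains is the set of $x\in\mathcal H$ such that $x\in D_s$ for all $s$ outside some $\mu$-negligible set (depending on $x$). For $x\in D_s$, $A_0(s,x)$ is the element of least norm of $A(s,x)$. For $x\in\mathcal H$ and $p\ge1$, $S_A^p(x)$ is the set of measurable functions $\phi:E\to\mathcal H$ with $\phi(s)\in A(s,x)$ for $\mu$-a.e. $s$ and $\int\|\phi\|^p d\mu<\infty$. The mean operator is the Aumann integral $\underline A(x)=\int A(s,x)\,d\mu(s)=\{\int\phi\,d\mu:\phi\in S_A^1(x)\}$ (Bochner integrals). $\mathrm{zer}(\underline A)=\{x: 0\in\underline A(x)\}$ and $\mathcal Z_A(p)=\{x\in\mathcal H:\exists\phi\in S_A^p(x),\ \int\phi\,d\mu=0\}$. A family $(f_i)_{i\in I}$ of ($\mu$-a.e. defined) measurable functions $E\to\mathbb R_+$ is uniformly integrable if $\lim_{a\to+\infty}\sup_i\int_{\{f_i>a\}}f_i\,d\mu=0$.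 *)

theory Defs
  imports "HOL-Probability.Probability"
begin

text \<open>
  A separable real Hilbert space is a type of sort
  \<open>{real_inner, banach, second_countable_topology}\<close>; a set-valued operator on it is a
  function \<open>'h \<Rightarrow> 'h set\<close>.
\<close>

definition graph_op :: "('h \<Rightarrow> 'h set) \<Rightarrow> ('h \<times> 'h) set" where
  "graph_op B = {(x, u). u \<in> B x}"

definition dom_op :: "('h \<Rightarrow> 'h set) \<Rightarrow> 'h set" where
  "dom_op B = {x. B x \<noteq> {}}"

definition zer :: "('h::zero \<Rightarrow> 'h set) \<Rightarrow> 'h set" where
  "zer B = {x. 0 \<in> B x}"

definition monotone_op :: "('h::real_inner \<Rightarrow> 'h set) \<Rightarrow> bool" where
  "monotone_op B \<longleftrightarrow>
     (\<forall>(x, u) \<in> graph_op B. \<forall>(y, v) \<in> graph_op B. 0 \<le> (x - y) \<bullet> (u - v))"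

definition maximal_monotone :: "('h::real_inner \<Rightarrow> 'h set) \<Rightarrow> bool" where
  "maximal_monotone B \<longleftrightarrow> monotone_op B \<and>
     (\<forall>C. monotone_op C \<and> graph_op B \<subseteq> graph_op C \<longrightarrow> graph_op C = graph_op B)"

text \<open>
  The set \<open>(I + \<lambda> B)\<inverse> x\<close> consists of the \<open>y\<close> with \<open>x \<in> y + \<lambda> B y\<close>. The function
  below returns its unique element; it is a meaningful value only when that set is a
  singleton, as is the case for \<open>\<lambda> > 0\<close> and maximal monotone \<open>B\<close>.
\<close>

definition resolvent :: "real \<Rightarrow> ('h::real_vector \<Rightarrow> 'h set) \<Rightarrow> 'h \<Rightarrow> 'h" where
  "resolvent l B x = the_elem {y. \<exists>u \<in> B y. x = y + l *\<^sub>R u}"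

text \<open>
  The element of least norm of \<open>B x\<close>; meaningful for \<open>x\<close> in the domain of a maximal
  monotone \<open>B\<close>, whose values are closed and convex.
\<close>

definition least_norm_sel :: "('h::real_normed_vector \<Rightarrow> 'h set) \<Rightarrow> 'h \<Rightarrow> 'h" where
  "least_norm_sel B x = (THE u. u \<in> B x \<and> (\<forall>v \<in> B x. norm u \<le> norm v))"

definition ess_dom :: "'e measure \<Rightarrow> ('e \<Rightarrow> 'h \<Rightarrow> 'h set) \<Rightarrow> 'h set" where
  "ess_dom M A = {x. AE s in M. x \<in> dom_op (A s)}"

definition selections ::
  "'e measure \<Rightarrow> ('e \<Rightarrow> 'h \<Rightarrow> 'h set) \<Rightarrow> real \<Rightarrow> 'h \<Rightarrow>
     ('e \<Rightarrow> 'h::{banach, second_countable_topology}) set" where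
  "selections M A p x =
     {\<phi> \<in> borel_measurable M. (AE s in M. \<phi> s \<in> A s x) \<and>
        (\<integral>\<^sup>+ s. ennreal (norm (\<phi> s) powr p) \<partial>M) < \<infinity>}"

definition mean_op ::
  "'e measure \<Rightarrow> ('e \<Rightarrow> 'h \<Rightarrow> 'h set) \<Rightarrow> 'h \<Rightarrow> 'h::{banach, second_countable_topology} set" where
  "mean_op M A x = {(\<integral>s. \<phi> s \<partial>M) |\<phi>. \<phi> \<in> selections M A 1 x}"

definition zer_sel ::
  "'e measure \<Rightarrow> ('e \<Rightarrow> 'h \<Rightarrow> 'h set) \<Rightarrow> real \<Rightarrow> 'h::{banach, second_countable_topology} set" where
  "zer_sel M A p = {x. \<exists>\<phi> \<in> selections M A p x. (\<integral>s. \<phi> s \<partial>M) = 0}"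

text \<open>
  The integrals are taken in \<^typ>\<open>ennreal\<close>, so that neither their finiteness nor that of
  their supremum is presupposed; the supremum over an empty family is \<open>0\<close>.
\<close>

definition uniformly_integrable_family ::
  "'e measure \<Rightarrow> 'i set \<Rightarrow> ('i \<Rightarrow> 'e \<Rightarrow> real) \<Rightarrow> bool" where
  "uniformly_integrable_family M I f \<longleftrightarrow>
     (\<forall>i \<in> I. f i \<in> borel_measurable M \<and> (AE s in M. 0 \<le> f i s)) \<and>
     ((\<lambda>a. SUP i \<in> I. \<integral>\<^sup>+ s \<in> {s \<in> space M. a < f i s}. ennreal (f i s) \<partial>M) \<longlongrightarrow> 0) at_top"

definition weakly_converges :: "(nat \<Rightarrow> 'h::real_normed_vector) \<Rightarrow> 'h \<Rightarrow> bool" where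
  "weakly_converges X x \<longleftrightarrow>
     (\<forall>f :: 'h \<Rightarrow> real. bounded_linear f \<longrightarrow> (\<lambda>n. f (X n)) \<longlonglongrightarrow> f x)"

primrec prox_seq ::
  "('e \<Rightarrow> 'h::real_vector \<Rightarrow> 'h set) \<Rightarrow> (nat \<Rightarrow> real) \<Rightarrow> (nat \<Rightarrow> 'w \<Rightarrow> 'e) \<Rightarrow> 'h \<Rightarrow>
     nat \<Rightarrow> 'w \<Rightarrow> 'h" where
  "prox_seq A l \<xi> x0 0 \<omega> = x0"
| "prox_seq A l \<xi> x0 (Suc n) \<omega> =
     resolvent (l n) (A (\<xi> (Suc n) \<omega>)) (prox_seq A l \<xi> x0 n \<omega>)"

definition weighted_avg :: "(nat \<Rightarrow> real) \<Rightarrow> (nat \<Rightarrow> 'h::real_vector) \<Rightarrow> nat \<Rightarrow> 'h" where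
  "weighted_avg l X n = (\<Sum>k=1..n. l k *\<^sub>R X k) /\<^sub>R (\<Sum>k=1..n. l k)"

end

theory Submission
  imports Defs "HOL-Library.Diagonal_Subsequence"
begin

text \<open>
  Write \<open>y\<^sub>n\<close> for the increment \<open>(x\<^sub>n - x\<^sub>n\<^sub>+\<^sub>1) / \<lambda>\<^sub>n\<close>, the Yosida approximation of the drawn operator
  at \<open>x\<^sub>n\<close>, and \<open>h\<^sub>n\<close> for its mean given the past.

  At a zero \<open>z\<close> of the mean operator there is a square-integrable selection with integral zero.
  Monotonicity against this selection yields a one-step estimate (\<open>proximal_step_estimate\<close>) in
  which the squared distance to \<open>z\<close> decreases up to a martingale difference and a term of order
  \<open>\<lambda>\<^sub>n\<^sup>2\<close>. Its expectation bounds the second moments of the iterates and gives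
  \<open>\<Sum> \<lambda>\<^sub>n\<^sup>2 E (norm y\<^sub>n)\<^sup>2 < \<infinity>\<close> (\<open>moment_bound\<close>); together with the convergence of square-integrable
  martingales (\<open>L2_martingale_differences.AE_summable\<close>) it shows that the distances to all zeros
  converge almost surely (\<open>AE_dist_to_zero_convergent\<close>).

  By Opial's argument (\<open>weighted_avg_weakly_converges\<close>) it remains to see that the weak cluster
  points of the averages are zeros. Since the mean operator is maximal, this follows if the
  averages \<open>a\<^sub>n\<close> satisfy \<open>limsup v \<bullet> (a\<^sub>n - x) \<le> 0\<close> for every point \<open>(x, v)\<close> of its graph. Here \<open>v\<close> is the
  integral of a selection \<open>\<phi>\<close> that is merely integrable, and a weighted law of large numbers for
  \<open>\<phi>(\<xi>\<^sub>n)\<close> can fail almost surely under the assumed step sizes. The noise is therefore removed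
  from \<open>y\<^sub>n\<close> instead of \<open>\<phi>(\<xi>\<^sub>n)\<close>: the series of \<open>\<lambda>\<^sub>n (y\<^sub>n - h\<^sub>n) \<bullet> (x\<^sub>n - x)\<close> converges by the bound on the
  increments, and expanding \<open>(norm (x\<^sub>n - x))\<^sup>2\<close> then shows that \<open>\<Sum> \<lambda>\<^sub>n h\<^sub>n \<bullet> (x\<^sub>n - x)\<close> is bounded above
  (\<open>AE_drift_bounded_above\<close>). Deterministically, \<open>liminf (h\<^sub>n - v) \<bullet> (x\<^sub>n - x) \<ge> 0\<close>
  (\<open>mean_Y_pairing_eventually_ge\<close>): where \<open>\<phi>\<close> is small this is monotonicity, and the rest of the
  integral is negligible because the Yosida approximations are dominated by the least-norm
  selections, which are uniformly integrable along the bounded path. This last domination needs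
  \<open>x\<^sub>n\<close> to lie in the domain of almost every operator, which is what the common domain guarantees.

  The resolvents are everywhere defined by Minty's theorem, which is proved here by minimising the
  Fitzpatrick function of the graph plus half the squared norm (\<open>minty_antidiagonal\<close>).
\<close>

section \<open>Minimisation in Hilbert space: Riesz representation and least-norm elements\<close>

text \<open>
  Strong midpoint convexity replaces compactness: it makes the diameters of the sublevel sets
  at levels close to the infimum tend to zero, so completeness gives them a common point.
\<close>

lemma strongly_convex_has_minimum:
  fixes f :: "'a::banach \<Rightarrow> real"
  assumes ne: "C \<noteq> {}" and closed: "\<And>r. closed {p \<in> C. f p \<le> r}"
    and bdd: "bdd_below (f ` C)" and c: "0 < c"
    and mid: "\<And>p q. p \<in> C \<Longrightarrow> q \<in> C \<Longrightarrow> midpoint p q \<in> C"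
    and conv: "\<And>p q. p \<in> C \<Longrightarrow> q \<in> C \<Longrightarrow>
      f (midpoint p q) \<le> (f p + f q) / 2 - c * (dist p q)\<^sup>2"
  shows "\<exists>p\<in>C. \<forall>q\<in>C. f p \<le> f q"
proof -
  define m where "m = Inf (f ` C)"
  have m: "m \<le> f p" if "p \<in> C" for p
    unfolding m_def using that bdd by (auto intro: cInf_lower)
  define S where "S n = {p \<in> C. f p \<le> m + inverse (real (Suc n))}" for n
  have small: "\<exists>n. \<forall>x \<in> S n. \<forall>y \<in> S n. dist x y < e" if e: "e > 0" for e
  proof -
    obtain n where n: "inverse (real (Suc n)) < c * e\<^sup>2"
      using reals_Archimedean[of "c * e\<^sup>2"] c e by auto
    show ?thesis
    proof (intro exI[of _ n] ballI)
      fix x y assume xy: "x \<in> S n" "y \<in> S n"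
      have "m \<le> (f x + f y) / 2 - c * (dist x y)\<^sup>2"
        using conv[of x y] m[of "midpoint x y"] mid[of x y] xy by (auto simp: S_def)
      moreover have "f x \<le> m + inverse (real (Suc n))" "f y \<le> m + inverse (real (Suc n))"
        using xy by (auto simp: S_def)
      ultimately have "c * (dist x y)\<^sup>2 \<le> inverse (real (Suc n))"
        by argo
      then have "c * (dist x y)\<^sup>2 < c * e\<^sup>2" using n by linarith
      then show "dist x y < e"
        using c e by (auto intro: power2_less_imp_less)
    qed
  qed
  have "\<exists>a. \<Inter>(range S) = {a}"
  proof (rule decreasing_closed_nest_sing)
    show "closed (S n)" for n unfolding S_def by (rule closed)
    show "S n \<noteq> {}" for n
    proof -
      have "\<exists>x\<in>f ` C. x < m + inverse (real (Suc n))"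
        unfolding m_def using ne bdd by (subst cInf_less_iff[symmetric]) auto
      then show ?thesis by (auto simp: S_def)
    qed
    show "S n \<subseteq> S k" if "k \<le> n" for k n
    proof -
      have "inverse (real (Suc n)) \<le> inverse (real (Suc k))"
        using that by (auto intro: le_imp_inverse_le)
      then show ?thesis by (auto simp: S_def intro: order_trans)
    qed
  qed (use small in auto)
  then obtain a where a: "a \<in> S n" for n by auto
  have "f a \<le> m"
  proof (rule field_le_epsilon)
    fix e :: real assume "e > 0"
    then obtain n where "inverse (real (Suc n)) < e" using reals_Archimedean by blast
    then show "f a \<le> m + e" using a[of n] by (auto simp: S_def)
  qed
  then show ?thesis using a[of 0] m by (auto simp: S_def intro!: bexI[of _ a] intro: order_trans)
qed

lemma norm_midpoint_sq:
  fixes p q :: "'a::real_inner"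
  shows "(norm (midpoint p q))\<^sup>2 = ((norm p)\<^sup>2 + (norm q)\<^sup>2) / 2 - (1/4) * (dist p q)\<^sup>2"
  by (simp add: midpoint_def dist_norm power2_norm_eq_inner inner_simps inner_commute field_simps)

lemma norm_add_scaleR_sq:
  fixes a b :: "'a::real_inner"
  shows "(norm (a + t *\<^sub>R b))\<^sup>2 = (norm a)\<^sup>2 + 2 * t * (a \<bullet> b) + t\<^sup>2 * (norm b)\<^sup>2"
  unfolding power2_norm_eq_inner
  by (simp add: inner_simps inner_commute power2_eq_square algebra_simps)

text \<open>First-order optimality in one variable, with the quadratic remainder made explicit.\<close>

lemma slope_nonneg_if_quadratic_nonneg:
  fixes d K :: real
  assumes "\<And>t. 0 < t \<Longrightarrow> t \<le> 1 \<Longrightarrow> 0 \<le> t * d + t\<^sup>2 * K"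
  shows "0 \<le> d"
proof (rule ccontr)
  assume "\<not> 0 \<le> d"
  then have d: "d < 0" by simp
  define t where "t = min 1 (- d / (2 * (\<bar>K\<bar> + 1)))"
  have "0 < - d / (2 * (\<bar>K\<bar> + 1))" using d by (intro divide_pos_pos) auto
  then have t: "0 < t" "t \<le> 1" by (auto simp: t_def)
  have "t \<le> - d / (2 * (\<bar>K\<bar> + 1))" by (simp add: t_def)
  then have "t * (2 * (\<bar>K\<bar> + 1)) \<le> - d" by (subst (asm) pos_le_divide_eq) auto
  moreover have "t * K \<le> t * (\<bar>K\<bar> + 1)" using t by (intro mult_left_mono) auto
  ultimately have "d + t * K < 0" using d by (simp add: algebra_simps)
  then have "t * (d + t * K) < 0" using t by (simp add: mult_pos_neg)
  with assms[OF t] show False by (simp add: algebra_simps power2_eq_square)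
qed

lemma riesz_representation:
  fixes f :: "'h::{real_inner, banach} \<Rightarrow> real"
  assumes "bounded_linear f"
  obtains w where "\<And>h. f h = w \<bullet> h"
proof -
  interpret bounded_linear f by fact
  obtain K where K: "\<And>x. \<bar>f x\<bar> \<le> norm x * K" using bounded by auto
  let ?g = "\<lambda>x. (norm x)\<^sup>2 / 2 - f x"
  have "\<exists>p\<in>UNIV. \<forall>q\<in>UNIV. ?g p \<le> ?g q"
  proof (rule strongly_convex_has_minimum[where c = "1/8"])
    show "closed {p \<in> UNIV. ?g p \<le> r}" for r
      by (auto intro!: closed_Collect_le continuous_intros linear_continuous_on[OF assms])
    have "- (K\<^sup>2 / 2) \<le> ?g x" for x
    proof -
      have "0 \<le> (norm x - K)\<^sup>2" by simp
      then show ?thesis using K[of x] by (simp add: power2_eq_square algebra_simps)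
    qed
    then show "bdd_below (?g ` UNIV)" by (intro bdd_belowI2[where m = "- (K\<^sup>2 / 2)"]) auto
    show "?g (midpoint p q) \<le> (?g p + ?g q) / 2 - 1 / 8 * (dist p q)\<^sup>2" for p q
    proof -
      have "f (midpoint p q) = (f p + f q) / 2" by (simp add: midpoint_def scaleR add)
      then show ?thesis unfolding norm_midpoint_sq by argo
    qed
  qed auto
  then obtain p where p: "?g p \<le> ?g q" for q by auto
  have "0 \<le> p \<bullet> h - f h" for h
  proof (rule slope_nonneg_if_quadratic_nonneg)
    fix t :: real
    show "0 \<le> t * (p \<bullet> h - f h) + t\<^sup>2 * ((norm h)\<^sup>2 / 2)"
      using p[of "p + t *\<^sub>R h"]
      by (simp add: norm_add_scaleR_sq add scaleR algebra_simps)
  qed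
  from this this[of "- h" for h] have "f h = p \<bullet> h" for h
    by (smt (verit) inner_minus_right neg)
  then show thesis by (rule that)
qed

lemma closed_convex_has_least_norm_element:
  fixes C :: "'h::{real_inner, banach} set"
  assumes "closed C" "C \<noteq> {}" and mid: "\<And>p q. p \<in> C \<Longrightarrow> q \<in> C \<Longrightarrow> midpoint p q \<in> C"
  shows "\<exists>!u. u \<in> C \<and> (\<forall>v\<in>C. norm u \<le> norm v)"
proof -
  have "\<exists>p\<in>C. \<forall>q\<in>C. (norm p)\<^sup>2 \<le> (norm q)\<^sup>2"
  proof (rule strongly_convex_has_minimum[where c = "1/4"])
    have "closed (C \<inter> {p. (norm p)\<^sup>2 \<le> r})" for r
      using assms by (intro closed_Int closed_Collect_le continuous_intros)
    then show "closed {p \<in> C. (norm p)\<^sup>2 \<le> r}" for r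
      by (simp add: Collect_conj_eq)
  qed (use assms in \<open>auto simp: norm_midpoint_sq intro!: bdd_belowI2[where m=0]\<close>)
  then obtain p where p: "p \<in> C" "\<And>v. v \<in> C \<Longrightarrow> norm p \<le> norm v" by auto
  have "q = p" if q: "q \<in> C" "\<forall>v\<in>C. norm q \<le> norm v" for q
  proof -
    have eq: "norm q = norm p" using p q by (metis order.antisym)
    have "(norm p)\<^sup>2 \<le> (norm (midpoint p q))\<^sup>2"
      using p mid[OF p(1) q(1)] by (intro power_mono) auto
    then have "dist p q = 0" by (simp add: norm_midpoint_sq eq)
    then show ?thesis by simp
  qed
  with p show ?thesis by blast
qed

section \<open>Maximal monotone operators and their resolvents\<close>

text \<open>
  Minty's theorem in the form that a maximal monotone graph meets the anti-diagonal. The proof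
  minimises the sum of the Fitzpatrick function of the graph and of half the squared norm. The
  Fitzpatrick function dominates the duality product, with equality on the graph; the optimality
  condition at the minimiser \<open>(x\<^sub>0, u\<^sub>0)\<close> then says that \<open>(- u\<^sub>0, - x\<^sub>0)\<close> is monotonically related
  to the graph with the margin \<open>(norm (x\<^sub>0 + u\<^sub>0))\<^sup>2\<close>. Maximality puts this point into the graph, and
  testing the margin at the point itself gives \<open>u\<^sub>0 = - x\<^sub>0\<close>.
\<close>

lemma minty_antidiagonal:
  fixes G :: "('h::{real_inner, banach} \<times> 'h) set"
  assumes mono: "\<And>x u y v. (x, u) \<in> G \<Longrightarrow> (y, v) \<in> G \<Longrightarrow> 0 \<le> (x - y) \<bullet> (u - v)"
    and maxi: "\<And>y v. (\<And>x u. (x, u) \<in> G \<Longrightarrow> 0 \<le> (x - y) \<bullet> (u - v)) \<Longrightarrow> (y, v) \<in> G"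
  shows "\<exists>x. (x, - x) \<in> G"
proof -
  \<comment> \<open>\<open>F\<close> is the Fitzpatrick function of \<open>G\<close> and \<open>C\<close> its effective domain.\<close>
  define k where "k p g = p \<bullet> (snd g, fst g) - fst g \<bullet> snd g" for p g :: "'h \<times> 'h"
  define C where "C = {p. bdd_above (k p ` G)}"
  define F where "F p = (SUP g\<in>G. k p g)" for p
  define f where "f p = F p + (norm p)\<^sup>2 / 2" for p
  have Gne: "G \<noteq> {}" using maxi by fastforce
  have kF: "k p g \<le> F p" if "p \<in> C" "g \<in> G" for p g
    unfolding F_def using that by (auto simp: C_def intro: cSUP_upper)
  have F_le: "F p \<le> r" if "\<And>g. g \<in> G \<Longrightarrow> k p g \<le> r" for p r
    unfolding F_def using that Gne by (auto intro: cSUP_least)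
  have inC: "p \<in> C" if "\<And>g. g \<in> G \<Longrightarrow> k p g \<le> r" for p r
    unfolding C_def mem_Collect_eq by (rule bdd_aboveI2) (rule that)
  have k_comb: "k ((1 - t) *\<^sub>R p + t *\<^sub>R q) g = (1 - t) * k p g + t * k q g" for t p q g
    by (simp add: k_def inner_simps algebra_simps)
  have k_comb_le: "k ((1 - t) *\<^sub>R p + t *\<^sub>R q) g \<le> (1 - t) * F p + t * F q"
    if "p \<in> C" "q \<in> C" "g \<in> G" "0 \<le> t" "t \<le> 1" for t p q g
    unfolding k_comb using that kF by (intro add_mono mult_left_mono) auto
  have mid_eq: "midpoint p q = (1 - 1/2) *\<^sub>R p + (1/2) *\<^sub>R q" for p q :: "'h \<times> 'h"
    by (simp add: midpoint_def scaleR_add_right)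
  have k_diag: "k p g \<le> fst p \<bullet> snd p" if "p \<in> G" "g \<in> G" for p g
    using mono[of "fst p" "snd p" "fst g" "snd g"] that
    by (simp add: k_def inner_prod_def inner_simps inner_commute)
  have GC: "G \<subseteq> C" using k_diag inC by blast
  have FG: "F p \<le> fst p \<bullet> snd p" if "p \<in> G" for p
    using k_diag that by (intro F_le) auto
  have F_ge: "fst p \<bullet> snd p \<le> F p" if p: "p \<in> C" for p
  proof (cases "p \<in> G")
    case True
    then show ?thesis using kF[OF p True] by (simp add: k_def inner_prod_def inner_commute)
  next
    case False
    then have "\<exists>x u. (x, u) \<in> G \<and> (x - fst p) \<bullet> (u - snd p) < 0"
      using maxi[of "fst p" "snd p"] by fastforce
    then obtain x u where xu: "(x, u) \<in> G" "(x - fst p) \<bullet> (u - snd p) < 0" by auto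
    then show ?thesis using kF[OF p xu(1)]
      by (simp add: k_def inner_prod_def inner_simps inner_commute)
  qed
  have "\<exists>p\<in>C. \<forall>q\<in>C. f p \<le> f q"
  proof (rule strongly_convex_has_minimum[where c = "1/8"])
    show "C \<noteq> {}" using Gne GC by auto
    have "{p \<in> C. f p \<le> r} = (\<Inter>g\<in>G. {p. k p g + (norm p)\<^sup>2 / 2 \<le> r})" for r
    proof (intro set_eqI iffI)
      fix p assume "p \<in> {p \<in> C. f p \<le> r}"
      then show "p \<in> (\<Inter>g\<in>G. {p. k p g + (norm p)\<^sup>2 / 2 \<le> r})"
        using kF[of p] by (fastforce simp: f_def)
    next
      fix p assume "p \<in> (\<Inter>g\<in>G. {p. k p g + (norm p)\<^sup>2 / 2 \<le> r})"
      then have "k p g \<le> r - (norm p)\<^sup>2 / 2" if "g \<in> G" for g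
        using that by fastforce
      from inC[OF this] F_le[OF this] show "p \<in> {p \<in> C. f p \<le> r}" by (auto simp: f_def)
    qed
    moreover have "closed (\<Inter>g\<in>G. {p. k p g + (norm p)\<^sup>2 / 2 \<le> r})" for r
      unfolding k_def by (intro closed_INT ballI closed_Collect_le continuous_intros) simp_all
    ultimately show "closed {p \<in> C. f p \<le> r}" for r by simp
    obtain g where g: "g \<in> G" using Gne by auto
    have "- (norm (snd g, fst g))\<^sup>2 / 2 - fst g \<bullet> snd g \<le> f p" if p: "p \<in> C" for p
    proof -
      have "0 \<le> (norm (p + (snd g, fst g)))\<^sup>2" by simp
      then have "- (norm (snd g, fst g))\<^sup>2 / 2 \<le> p \<bullet> (snd g, fst g) + (norm p)\<^sup>2 / 2"
        by (simp add: power2_norm_eq_inner inner_add_left inner_add_right inner_commute)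
      then show ?thesis using kF[OF p g] by (simp add: f_def k_def)
    qed
    then show "bdd_below (f ` C)" by (intro bdd_belowI2) auto
    fix p q assume pq: "p \<in> C" "q \<in> C"
    have le: "k (midpoint p q) g \<le> (F p + F q) / 2" if "g \<in> G" for g
      using k_comb_le[OF pq that, of "1/2"] unfolding mid_eq by simp
    show "midpoint p q \<in> C" using le by (rule inC)
    show "f (midpoint p q) \<le> (f p + f q) / 2 - 1 / 8 * (dist p q)\<^sup>2"
      using F_le[OF le] by (simp add: f_def norm_midpoint_sq field_simps)
  qed simp
  then obtain p where p: "p \<in> C" and pmin: "\<And>q. q \<in> C \<Longrightarrow> f p \<le> f q" by auto
  obtain x0 u0 where p_eq: "p = (x0, u0)" by (cases p)
  have opt: "0 \<le> F q - F p + p \<bullet> (q - p)" if q: "q \<in> C" for q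
  proof (rule slope_nonneg_if_quadratic_nonneg)
    fix t :: real assume t: "0 < t" "t \<le> 1"
    let ?r = "(1 - t) *\<^sub>R p + t *\<^sub>R q"
    have le: "k ?r g \<le> (1 - t) * F p + t * F q" if "g \<in> G" for g
      using k_comb_le[OF p q that] t by simp
    have "f p \<le> (1 - t) * F p + t * F q + (norm ?r)\<^sup>2 / 2"
      using pmin[OF inC[OF le]] F_le[OF le] by (simp add: f_def)
    moreover have "?r = p + t *\<^sub>R (q - p)" by (simp add: algebra_simps)
    then have "(norm ?r)\<^sup>2 = (norm p)\<^sup>2 + 2 * t * (p \<bullet> (q - p)) + t\<^sup>2 * (norm (q - p))\<^sup>2"
      by (simp only: norm_add_scaleR_sq)
    ultimately show "0 \<le> t * (F q - F p + p \<bullet> (q - p)) + t\<^sup>2 * ((norm (q - p))\<^sup>2 / 2)"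
      by (simp add: f_def algebra_simps)
  qed
  have margin: "(norm (x0 + u0))\<^sup>2 \<le> (x - (- u0)) \<bullet> (u - (- x0))" if xu: "(x, u) \<in> G" for x u
  proof -
    have "F p \<le> x \<bullet> u + p \<bullet> ((x, u) - p)"
      using opt[of "(x, u)"] FG[OF xu] GC xu by (force simp: algebra_simps)
    moreover have "x0 \<bullet> u0 \<le> F p" using F_ge[OF p] by (simp add: p_eq)
    ultimately show ?thesis
      by (simp add: p_eq inner_simps inner_commute power2_norm_eq_inner)
  qed
  have "(- u0, - x0) \<in> G"
    by (rule maxi) (use margin in \<open>meson order_trans zero_le_power2\<close>)
  moreover from margin[OF this] have "u0 = - x0"
    by (simp add: add_eq_0_iff)
  ultimately show ?thesis by auto
qed

lemma monotone_opD:
  assumes "monotone_op B" "u \<in> B x" "v \<in> B y"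
  shows "0 \<le> (x - y) \<bullet> (u - v)"
  using assms by (force simp: monotone_op_def graph_op_def)

lemma maximal_monotoneD_mono:
  assumes "maximal_monotone B" "u \<in> B x" "v \<in> B y"
  shows "0 \<le> (x - y) \<bullet> (u - v)"
  using assms by (auto simp: maximal_monotone_def intro: monotone_opD)

lemma maximal_monotoneD_max:
  assumes B: "maximal_monotone B" and rel: "\<And>x u. u \<in> B x \<Longrightarrow> 0 \<le> (x - y) \<bullet> (u - v)"
  shows "v \<in> B y"
proof -
  define C where "C x = (if x = y then insert v (B x) else B x)" for x
  have sym: "0 \<le> (y - x) \<bullet> (v - u)" if "u \<in> B x" for x u
    using rel[OF that] by (simp add: inner_simps)
  have "monotone_op C"
    using rel sym maximal_monotoneD_mono[OF B]
    by (auto simp: monotone_op_def graph_op_def C_def split: if_splits)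
  moreover have "graph_op B \<subseteq> graph_op C"
    by (auto simp: graph_op_def C_def)
  ultimately have "graph_op C = graph_op B"
    using B by (auto simp: maximal_monotone_def)
  moreover have "(y, v) \<in> graph_op C" by (simp add: graph_op_def C_def)
  ultimately show ?thesis by (simp add: graph_op_def)
qed

text \<open>
  The value at a point is cut out by the linear inequalities of monotone relatedness, hence closed
  and convex, so that the definite description in the definition of the selection is proper.
\<close>

lemma least_norm_sel_mem:
  fixes B :: "'h::{real_inner, banach} \<Rightarrow> 'h set"
  assumes B: "maximal_monotone B" and x: "x \<in> dom_op B"
  shows "least_norm_sel B x \<in> B x"
proof -
  have eq: "B x = (\<Inter>(y, v) \<in> {(y, v). v \<in> B y}. {u. 0 \<le> (y - x) \<bullet> (v - u)})"
    using maximal_monotoneD_mono[OF B] maximal_monotoneD_max[OF B, of x] by auto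
  have "\<exists>!u. u \<in> B x \<and> (\<forall>v\<in>B x. norm u \<le> norm v)"
  proof (rule closed_convex_has_least_norm_element)
    show "closed (B x)"
      by (subst eq) (auto intro!: closed_INT closed_Collect_le continuous_intros)
    show "B x \<noteq> {}" using x by (simp add: dom_op_def)
    show "midpoint p q \<in> B x" if "p \<in> B x" "q \<in> B x" for p q
    proof (rule maximal_monotoneD_max[OF B])
      fix y v assume v: "v \<in> B y"
      have "(y - x) \<bullet> (v - midpoint p q) = ((y - x) \<bullet> (v - p) + (y - x) \<bullet> (v - q)) / 2"
        by (simp add: midpoint_def inner_simps field_simps)
      then show "0 \<le> (y - x) \<bullet> (v - midpoint p q)"
        using maximal_monotoneD_mono[OF B v that(1)] maximal_monotoneD_mono[OF B v that(2)] by simp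
    qed
  qed
  from theI'[OF this] show ?thesis by (auto simp: least_norm_sel_def)
qed

definition yosida :: "real \<Rightarrow> ('h::real_vector \<Rightarrow> 'h set) \<Rightarrow> 'h \<Rightarrow> 'h" where
  "yosida r B x = (x - resolvent r B x) /\<^sub>R r"

lemma resolvent_decomp: "r \<noteq> 0 \<Longrightarrow> x = resolvent r B x + r *\<^sub>R yosida r B x"
  by (simp add: yosida_def)

text \<open>
  For the graph of \<open>r B - x\<close>, the anti-diagonal point provided by Minty's theorem is the
  solution \<open>y\<close> of \<open>x \<in> y + r B y\<close>.
\<close>

lemma yosida_mem:
  fixes B :: "'h::{real_inner, banach} \<Rightarrow> 'h set"
  assumes B: "maximal_monotone B" and r: "0 < r"
  shows "yosida r B x \<in> B (resolvent r B x)"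
proof -
  let ?G = "{(y, r *\<^sub>R u - x) | y u. u \<in> B y}"
  have "\<exists>y. (y, - y) \<in> ?G"
  proof (rule minty_antidiagonal)
    fix y u z v assume "(y, u) \<in> ?G" "(z, v) \<in> ?G"
    then obtain u' v' where *: "u = r *\<^sub>R u' - x" "v = r *\<^sub>R v' - x" "u' \<in> B y" "v' \<in> B z" by auto
    have "(y - z) \<bullet> (u - v) = r * ((y - z) \<bullet> (u' - v'))"
      by (simp add: * inner_simps right_diff_distrib)
    then show "0 \<le> (y - z) \<bullet> (u - v)"
      using maximal_monotoneD_mono[OF B *(3,4)] r by simp
  next
    fix z v assume rel: "\<And>y u. (y, u) \<in> ?G \<Longrightarrow> 0 \<le> (y - z) \<bullet> (u - v)"
    have "(v + x) /\<^sub>R r \<in> B z"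
    proof (rule maximal_monotoneD_max[OF B])
      fix y u assume "u \<in> B y"
      then have "0 \<le> (y - z) \<bullet> (r *\<^sub>R u - x - v)" by (intro rel) auto
      moreover have "r *\<^sub>R u - x - v = r *\<^sub>R (u - (v + x) /\<^sub>R r)"
        using r by (simp add: algebra_simps)
      ultimately show "0 \<le> (y - z) \<bullet> (u - (v + x) /\<^sub>R r)"
        using r by (simp add: zero_le_mult_iff)
    qed
    then show "(z, v) \<in> ?G" using r by (auto intro!: exI[of _ "(v + x) /\<^sub>R r"])
  qed
  then obtain y u where y: "u \<in> B y" "x = y + r *\<^sub>R u" by (force simp: algebra_simps)
  have "z = y" if z: "v \<in> B z" "x = z + r *\<^sub>R v" for z v
  proof -
    have "r *\<^sub>R (v - u) = y - z" using z y by (simp add: algebra_simps)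
    then have "r * ((z - y) \<bullet> (v - u)) = - (norm (z - y))\<^sup>2"
      by (metis inner_minus_right inner_scaleR_right minus_diff_eq power2_norm_eq_inner)
    moreover have "0 \<le> r * ((z - y) \<bullet> (v - u))"
      using maximal_monotoneD_mono[OF B z(1) y(1)] r by simp
    ultimately show ?thesis by simp
  qed
  then have "{y. \<exists>u \<in> B y. x = y + r *\<^sub>R u} = {y}" using y by blast
  then have "resolvent r B x = y" by (simp add: resolvent_def)
  then show ?thesis using y r by (simp add: yosida_def)
qed

lemma resolvent_in_dom:
  fixes B :: "'h::{real_inner, banach} \<Rightarrow> 'h set"
  assumes "maximal_monotone B" "0 < r"
  shows "resolvent r B x \<in> dom_op B"
  using yosida_mem[OF assms] by (auto simp: dom_op_def)

lemma resolvent_nonexpansive: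
  fixes B :: "'h::{real_inner, banach} \<Rightarrow> 'h set"
  assumes B: "maximal_monotone B" and r: "0 < r"
  shows "norm (resolvent r B x - resolvent r B y) \<le> norm (x - y)"
proof -
  let ?a = "resolvent r B x - resolvent r B y" and ?b = "yosida r B x - yosida r B y"
  have "x - y = ?a + r *\<^sub>R ?b"
    using resolvent_decomp[of r x B] resolvent_decomp[of r y B] r by (simp add: algebra_simps)
  then have "(norm (x - y))\<^sup>2 = (norm ?a)\<^sup>2 + 2 * r * (?a \<bullet> ?b) + r\<^sup>2 * (norm ?b)\<^sup>2"
    by (simp only: norm_add_scaleR_sq)
  moreover have "0 \<le> ?a \<bullet> ?b"
    by (rule maximal_monotoneD_mono[OF B]) (auto intro: yosida_mem[OF B r])
  moreover have "0 \<le> r * (?a \<bullet> ?b)" "0 \<le> r\<^sup>2 * (norm ?b)\<^sup>2"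
    using calculation r by (auto intro: mult_nonneg_nonneg)
  ultimately have "(norm ?a)\<^sup>2 \<le> (norm (x - y))\<^sup>2" by linarith
  then show ?thesis by (rule power2_le_imp_le) simp
qed

lemma yosida_norm_le:
  fixes B :: "'h::{real_inner, banach} \<Rightarrow> 'h set"
  assumes B: "maximal_monotone B" and r: "0 < r" and u: "u \<in> B x"
  shows "norm (yosida r B x) \<le> norm u"
proof -
  let ?y = "yosida r B x"
  have "0 \<le> (x - resolvent r B x) \<bullet> (u - ?y)"
    by (rule maximal_monotoneD_mono[OF B u yosida_mem[OF B r]])
  also have "x - resolvent r B x = r *\<^sub>R ?y" using r by (simp add: yosida_def)
  finally have "?y \<bullet> ?y \<le> ?y \<bullet> u" using r by (simp add: inner_simps zero_le_mult_iff)
  also have "\<dots> \<le> norm ?y * norm u" by (rule norm_cauchy_schwarz)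
  finally have "norm ?y * norm ?y \<le> norm ?y * norm u" by (simp add: norm_eq_sqrt_inner)
  then show ?thesis by (cases "?y = 0") auto
qed

section \<open>Weak compactness and weighted averages\<close>

text \<open>
  Weak sequential compactness of bounded sets: a diagonal subsequence makes the inner products
  with a countable dense set converge, boundedness extends this to all vectors, and the limit
  functional is represented by a vector.
\<close>

lemma bounded_has_weakly_convergent_subseq:
  fixes X :: "nat \<Rightarrow> 'h::{real_inner, banach, second_countable_topology}"
  assumes B: "\<And>n. norm (X n) \<le> B"
  shows "\<exists>r p. strict_mono r \<and> (\<forall>h. (\<lambda>n. X (r n) \<bullet> h) \<longlonglongrightarrow> p \<bullet> h)"
proof -
  obtain D :: "'h set" where D: "countable D" "\<And>U. open U \<Longrightarrow> U \<noteq> {} \<Longrightarrow> \<exists>d\<in>D. d \<in> U"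
    by (rule countable_dense_setE) blast
  have "D \<noteq> {}" using D(2)[of UNIV] by auto
  define d where "d = from_nat_into D"
  have range_d: "range d = D"
    unfolding d_def by (rule range_from_nat_into) fact+
  have inner_le: "\<bar>X n \<bullet> h\<bar> \<le> B * norm h" for n h
    using Cauchy_Schwarz_ineq2[of "X n" h] mult_right_mono[OF B[of n], of "norm h"] by simp
  interpret subseqs "\<lambda>n s. convergent (\<lambda>i. X (s i) \<bullet> d n)"
  proof
    fix n and s :: "nat \<Rightarrow> nat"
    have "bounded (range (\<lambda>i. X (s i) \<bullet> d n))"
      by (rule boundedI[where B = "B * norm (d n)"]) (auto intro: inner_le)
    then obtain l r where "strict_mono r" "((\<lambda>i. X (s i) \<bullet> d n) \<circ> r) \<longlonglongrightarrow> l"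
      using bounded_imp_convergent_subsequence by blast
    then show "\<exists>r'. strict_mono r' \<and> convergent (\<lambda>i. X ((s \<circ> r') i) \<bullet> d n)"
      by (auto simp: convergent_def o_def)
  qed
  define r where "r = diagseq"
  have r: "strict_mono r" unfolding r_def by (rule subseq_diagseq)
  have conv_d: "convergent (\<lambda>i. X (r i) \<bullet> d k)" for k
  proof -
    have "convergent (\<lambda>i. X ((diagseq \<circ> ((+) (Suc k))) i) \<bullet> d k)"
    proof (rule diagseq_holds)
      fix s t :: "nat \<Rightarrow> nat" and n
      assume "strict_mono s" "convergent (\<lambda>i. X (t i) \<bullet> d n)"
      then show "convergent (\<lambda>i. X ((t \<circ> s) i) \<bullet> d n)"
        using convergent_subseq_convergent[of "\<lambda>i. X (t i) \<bullet> d n" s] by (simp add: o_def)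
    qed
    then have "convergent (\<lambda>i. X (r (i + Suc k)) \<bullet> d k)"
      by (simp add: r_def o_def add.commute)
    then show ?thesis by (rule convergent_ignore_initial_segment[THEN iffD1])
  qed
  have "Cauchy (\<lambda>i. X (r i) \<bullet> h)" for h
  proof (rule metric_CauchyI)
    fix e :: real assume e: "0 < e"
    have B0: "0 \<le> B" using B[of 0] norm_ge_zero order_trans by blast
    define \<delta> where "\<delta> = e / (4 * (B + 1))"
    have \<delta>: "0 < \<delta>" using e B0 by (simp add: \<delta>_def)
    have B\<delta>: "B * \<delta> \<le> e / 4"
    proof -
      have "B * \<delta> \<le> (B + 1) * \<delta>" using \<delta> by (simp add: mult_right_mono)
      also have "\<dots> = e / 4"
      proof -
        have "B + 1 \<noteq> 0" using B0 by simp
        then show ?thesis by (simp add: \<delta>_def divide_simps)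
      qed
      finally show ?thesis .
    qed
    obtain k where k: "dist (d k) h < \<delta>"
      using D(2)[of "ball h \<delta>"] \<delta> range_d by (auto simp: dist_commute)
    have "Cauchy (\<lambda>i. X (r i) \<bullet> d k)" by (rule convergent_Cauchy[OF conv_d])
    then obtain N where N: "\<And>m n. m \<ge> N \<Longrightarrow> n \<ge> N \<Longrightarrow> dist (X (r m) \<bullet> d k) (X (r n) \<bullet> d k) < e / 2"
      using metric_CauchyD[of "\<lambda>i. X (r i) \<bullet> d k" "e / 2"] e by auto
    have near: "\<bar>X n \<bullet> h - X n \<bullet> d k\<bar> \<le> e / 4" for n
    proof -
      have "\<bar>X n \<bullet> (h - d k)\<bar> \<le> B * \<delta>"
        using inner_le[of n "h - d k"] k B0
        by (smt (verit) dist_norm norm_minus_commute mult_left_mono)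
      then show ?thesis using B\<delta> by (simp add: inner_diff_right)
    qed
    show "\<exists>N. \<forall>m\<ge>N. \<forall>n\<ge>N. dist (X (r m) \<bullet> h) (X (r n) \<bullet> h) < e"
    proof (intro exI allI impI)
      fix m n assume "N \<le> m" "N \<le> n"
      from N[OF this] near[of "r m"] near[of "r n"]
      show "dist (X (r m) \<bullet> h) (X (r n) \<bullet> h) < e" unfolding dist_real_def by linarith
    qed
  qed
  then have conv: "convergent (\<lambda>i. X (r i) \<bullet> h)" for h
    by (simp add: real_Cauchy_convergent)
  define f where "f h = lim (\<lambda>i. X (r i) \<bullet> h)" for h
  have f: "(\<lambda>i. X (r i) \<bullet> h) \<longlonglongrightarrow> f h" for h
    using conv convergent_LIMSEQ_iff unfolding f_def by blast
  have "bounded_linear f"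
  proof (rule bounded_linear_intro)
    show "f (x + y) = f x + f y" for x y
      using LIMSEQ_unique[OF f] tendsto_add[OF f[of x] f[of y]] by (simp add: inner_add_right)
    show "f (c *\<^sub>R x) = c *\<^sub>R f x" for c x
      using LIMSEQ_unique[OF f] tendsto_mult_left[OF f[of x], of c] by simp
    show "norm (f x) \<le> norm x * B" for x
    proof (rule LIMSEQ_le_const2)
      show "(\<lambda>i. norm (X (r i) \<bullet> x)) \<longlonglongrightarrow> norm (f x)" by (intro tendsto_norm f)
      show "\<exists>N. \<forall>n\<ge>N. norm (X (r n) \<bullet> x) \<le> norm x * B"
        using inner_le[of "r n" x for n] by (auto simp: mult.commute)
    qed
  qed
  from riesz_representation[OF this] obtain p where "\<And>h. f h = p \<bullet> h" by blast
  with f have "\<And>h. (\<lambda>i. X (r i) \<bullet> h) \<longlonglongrightarrow> p \<bullet> h" by metis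
  with r show ?thesis by blast
qed

lemma weighted_avg_linear:
  assumes "bounded_linear f"
  shows "f (weighted_avg l X n) = weighted_avg l (\<lambda>k. f (X k)) n"
proof -
  interpret bounded_linear f by fact
  show ?thesis by (simp add: weighted_avg_def scaleR sum)
qed

lemma weights_at_top:
  fixes l :: "nat \<Rightarrow> real"
  assumes "filterlim (\<lambda>n. \<Sum>k<n. l k) at_top sequentially"
  shows "filterlim (\<lambda>n. \<Sum>k=1..n. l k) at_top sequentially"
proof -
  have "(\<Sum>k=1..n. l k) = - l 0 + (\<Sum>k<Suc n. l k)" for n
    by (induction n) simp_all
  moreover have "filterlim (\<lambda>n. - l 0 + (\<Sum>k<Suc n. l k)) at_top sequentially"
    using filterlim_compose[OF assms filterlim_Suc]
    by (intro filterlim_tendsto_add_at_top[OF tendsto_const]) simp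
  ultimately show ?thesis by (simp only:)
qed

context
  fixes l :: "nat \<Rightarrow> real"
  assumes pos: "\<And>k. 0 < l k" and inf: "filterlim (\<lambda>n. \<Sum>k=1..n. l k) at_top sequentially"
begin

lemma weighted_avg_eventually_le:
  fixes a :: "nat \<Rightarrow> real"
  assumes a: "\<forall>\<^sub>F k in sequentially. a k \<le> c" and e: "0 < e"
  shows "\<forall>\<^sub>F n in sequentially. weighted_avg l a n \<le> c + e"
proof -
  obtain N where N: "\<And>k. N \<le> k \<Longrightarrow> a k \<le> c" using a by (auto simp: eventually_sequentially)
  define K where "K = (\<Sum>k<N. l k * \<bar>a k - c\<bar>)"
  have K: "(\<Sum>k=1..n. l k * (a k - c)) \<le> K" for n
  proof -
    have "(\<Sum>k=1..n. l k * (a k - c)) \<le> (\<Sum>k=1..n. if k < N then l k * \<bar>a k - c\<bar> else 0)"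
    proof (rule sum_mono)
      fix k
      show "l k * (a k - c) \<le> (if k < N then l k * \<bar>a k - c\<bar> else 0)"
        using pos[of k] N[of k] by (auto simp: mult_le_0_iff less_imp_le not_less)
    qed
    also have "\<dots> = (\<Sum>k\<in>{1..n} \<inter> {k. k < N}. l k * \<bar>a k - c\<bar>)"
      by (simp add: sum.inter_restrict)
    also have "\<dots> \<le> K" unfolding K_def
      by (intro sum_mono2) (auto intro!: mult_nonneg_nonneg less_imp_le[OF pos])
    finally show ?thesis .
  qed
  have "\<forall>\<^sub>F n in sequentially. max 1 (K / e) \<le> (\<Sum>k=1..n. l k)"
    using inf unfolding filterlim_at_top by blast
  then show ?thesis
  proof eventually_elim
    fix n assume *: "max 1 (K / e) \<le> (\<Sum>k=1..n. l k)"
    let ?W = "\<Sum>k=1..n. l k"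
    have W: "0 < ?W" using * by linarith
    have "(\<Sum>k=1..n. l k * a k) \<le> c * ?W + K"
      using K[of n] by (simp add: right_diff_distrib sum_subtractf sum_distrib_left mult.commute)
    also have "K \<le> e * ?W" using * e by (simp add: field_simps)
    finally show "weighted_avg l a n \<le> c + e"
      using W by (simp add: weighted_avg_def divide_inverse[symmetric] field_simps)
  qed
qed

lemma weighted_avg_tendsto:
  fixes a :: "nat \<Rightarrow> real"
  assumes a: "a \<longlonglongrightarrow> L"
  shows "weighted_avg l a \<longlonglongrightarrow> L"
proof (rule order_tendstoI)
  have minus: "weighted_avg l (\<lambda>k. - a k) n = - weighted_avg l a n" for n
    using weighted_avg_linear[OF bounded_linear_minus[OF bounded_linear_ident], of l a n] by simp
  fix y :: real
  show "\<forall>\<^sub>F n in sequentially. weighted_avg l a n < y" if "L < y"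
  proof -
    have "\<forall>\<^sub>F k in sequentially. a k \<le> (2 * L + y) / 3"
      using order_tendstoD(2)[OF a, of "(2 * L + y) / 3"] that
      by (auto elim: eventually_mono intro: less_imp_le)
    from weighted_avg_eventually_le[OF this, of "(y - L) / 3"] that
    show ?thesis by (auto elim!: eventually_mono simp: field_simps)
  qed
  show "\<forall>\<^sub>F n in sequentially. y < weighted_avg l a n" if "y < L"
  proof -
    have "\<forall>\<^sub>F k in sequentially. - a k \<le> - ((2 * L + y) / 3)"
      using order_tendstoD(1)[OF a, of "(2 * L + y) / 3"] that
      by (auto elim: eventually_mono intro: less_imp_le)
    from weighted_avg_eventually_le[OF this, of "(L - y) / 3"] that
    show ?thesis by (auto elim!: eventually_mono simp: field_simps minus)
  qed
qed

lemma norm_weighted_avg_le: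
  fixes X :: "nat \<Rightarrow> 'a::real_normed_vector"
  assumes B: "\<And>k. norm (X k) \<le> B"
  shows "norm (weighted_avg l X n) \<le> B"
proof (cases "n = 0")
  case True
  moreover have "0 \<le> B" using B[of 0] norm_ge_zero[of "X 0"] by linarith
  ultimately show ?thesis by (simp add: weighted_avg_def)
next
  case False
  let ?W = "\<Sum>k=1..n. l k"
  have W: "0 < ?W" using False pos by (intro sum_pos) auto
  have "norm (\<Sum>k=1..n. l k *\<^sub>R X k) \<le> (\<Sum>k=1..n. l k * B)"
    using pos B by (intro sum_norm_le) (auto simp: abs_of_pos intro: mult_left_mono less_imp_le)
  also have "\<dots> = ?W * B" by (rule sum_distrib_right[symmetric])
  finally show ?thesis using W by (simp add: weighted_avg_def field_simps)
qed

text \<open>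
  Opial's argument for averages. If the distances of the sequence to \<open>z\<close> and \<open>z'\<close> converge, then
  so does its inner product with \<open>z - z'\<close>, by polarisation, and the averages have the same limit.
  Two weak cluster points \<open>z\<close>, \<open>z'\<close> of the averages therefore satisfy \<open>z \<bullet> (z - z') = z' \<bullet> (z - z')\<close>,
  that is, they coincide.
\<close>

lemma weighted_avg_weakly_converges:
  fixes X :: "nat \<Rightarrow> 'h::{real_inner, banach, second_countable_topology}"
  assumes ne: "Z \<noteq> {}" and dist_conv: "\<And>z. z \<in> Z \<Longrightarrow> convergent (\<lambda>n. norm (X n - z))"
    and cluster: "\<And>r p. strict_mono r \<Longrightarrow> (\<And>h. (\<lambda>n. weighted_avg l X (r n) \<bullet> h) \<longlonglongrightarrow> p \<bullet> h) \<Longrightarrow> p \<in> Z"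
  shows "\<exists>z\<in>Z. weakly_converges (weighted_avg l X) z"
proof -
  let ?a = "weighted_avg l X"
  obtain z0 where z0: "z0 \<in> Z" using ne by auto
  obtain B0 where B0: "\<And>n. \<bar>norm (X n - z0)\<bar> \<le> B0"
    using convergent_imp_Bseq[OF dist_conv[OF z0]] by (auto simp: Bseq_def)
  have "norm (X n) \<le> B0 + norm z0" for n
    using B0[of n] norm_triangle_sub[of "X n" z0] by simp
  then have bdd: "norm (?a n) \<le> B0 + norm z0" for n
    by (rule norm_weighted_avg_le)
  have avg_inner: "?a n \<bullet> h = weighted_avg l (\<lambda>k. X k \<bullet> h) n" for n h
    by (rule weighted_avg_linear[OF bounded_linear_inner_left])
  have unique: "z = z'"
    if z: "z \<in> Z" "strict_mono r" "\<And>h. (\<lambda>n. ?a (r n) \<bullet> h) \<longlonglongrightarrow> z \<bullet> h"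
      and z': "z' \<in> Z" "strict_mono r'" "\<And>h. (\<lambda>n. ?a (r' n) \<bullet> h) \<longlonglongrightarrow> z' \<bullet> h" for z z' r r'
  proof -
    obtain L L' where L: "(\<lambda>n. norm (X n - z)) \<longlonglongrightarrow> L" "(\<lambda>n. norm (X n - z')) \<longlonglongrightarrow> L'"
      using dist_conv[OF z(1)] dist_conv[OF z'(1)] by (auto simp: convergent_def)
    have polar: "X n \<bullet> (z - z') =
      ((norm (X n - z'))\<^sup>2 - (norm (X n - z))\<^sup>2 + (norm z)\<^sup>2 - (norm z')\<^sup>2) / 2" for n
      by (simp add: power2_norm_eq_inner inner_diff_left inner_diff_right inner_commute)
    have "(\<lambda>n. X n \<bullet> (z - z')) \<longlonglongrightarrow> (L'\<^sup>2 - L\<^sup>2 + (norm z)\<^sup>2 - (norm z')\<^sup>2) / 2"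
      unfolding polar by (intro tendsto_intros L) simp
    then have lim: "(\<lambda>n. ?a n \<bullet> (z - z')) \<longlonglongrightarrow> (L'\<^sup>2 - L\<^sup>2 + (norm z)\<^sup>2 - (norm z')\<^sup>2) / 2"
      unfolding avg_inner by (rule weighted_avg_tendsto)
    have "z \<bullet> (z - z') = z' \<bullet> (z - z')"
      using LIMSEQ_unique[OF z(3)[of "z - z'"] LIMSEQ_subseq_LIMSEQ[OF lim z(2), unfolded o_def]]
        LIMSEQ_unique[OF z'(3)[of "z - z'"] LIMSEQ_subseq_LIMSEQ[OF lim z'(2), unfolded o_def]]
      by simp
    then have "(z - z') \<bullet> (z - z') = 0" by (simp add: inner_diff_left)
    then show "z = z'" by simp
  qed
  obtain r z where rz: "strict_mono r" "\<And>h. (\<lambda>n. ?a (r n) \<bullet> h) \<longlonglongrightarrow> z \<bullet> h"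
    using bounded_has_weakly_convergent_subseq[of ?a, OF bdd] by metis
  have zZ: "z \<in> Z" using cluster[OF rz] .
  have lim: "(\<lambda>n. ?a n \<bullet> h) \<longlonglongrightarrow> z \<bullet> h" for h
  proof (rule ccontr)
    assume "\<not> (\<lambda>n. ?a n \<bullet> h) \<longlonglongrightarrow> z \<bullet> h"
    then obtain e where e: "e > 0" "\<exists>\<^sub>F n in sequentially. e \<le> dist (?a n \<bullet> h) (z \<bullet> h)"
      by (auto simp: tendsto_iff not_eventually not_less)
    then have "infinite {n. e \<le> dist (?a n \<bullet> h) (z \<bullet> h)}"
      by (simp add: frequently_cofinite flip: cofinite_eq_sequentially)
    then obtain s where s: "strict_mono (s :: nat \<Rightarrow> nat)" "\<And>n. e \<le> dist (?a (s n) \<bullet> h) (z \<bullet> h)"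
      using infinite_enumerate by blast
    obtain t z' where t: "strict_mono t" "\<And>h. (\<lambda>n. ?a (s (t n)) \<bullet> h) \<longlonglongrightarrow> z' \<bullet> h"
      using bounded_has_weakly_convergent_subseq[of "\<lambda>n. ?a (s n)", OF bdd] by metis
    have st: "strict_mono (\<lambda>n. s (t n))" using s(1) t(1) by (simp add: strict_mono_def)
    have "z' = z" using unique[OF cluster[OF st t(2)] st t(2) zZ rz] .
    then have "\<forall>\<^sub>F n in sequentially. dist (?a (s (t n)) \<bullet> h) (z \<bullet> h) < e"
      using t(2)[of h] e(1) by (auto simp: tendsto_iff)
    then obtain n where "dist (?a (s (t n)) \<bullet> h) (z \<bullet> h) < e"
      by (auto dest: eventually_happens)
    then show False using s(2)[of "t n"] by simp
  qed
  have "(\<lambda>n. f (?a n)) \<longlonglongrightarrow> f z" if "bounded_linear f" for f :: "'h \<Rightarrow> real"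
  proof -
    obtain w where "\<And>h. f h = w \<bullet> h" using riesz_representation[OF \<open>bounded_linear f\<close>] by blast
    then show ?thesis using lim[of w] by (simp add: inner_commute)
  qed
  then show ?thesis using zZ by (auto simp: weakly_converges_def)
qed

end

section \<open>Convergence of square-integrable martingales\<close>

lemma integrable_mult_of_squares:
  fixes f g :: "'a \<Rightarrow> real"
  assumes [measurable]: "f \<in> borel_measurable M" "g \<in> borel_measurable M"
    and "integrable M (\<lambda>x. (f x)\<^sup>2)" "integrable M (\<lambda>x. (g x)\<^sup>2)"
  shows "integrable M (\<lambda>x. f x * g x)"
proof (rule Bochner_Integration.integrable_bound)
  show "integrable M (\<lambda>x. (f x)\<^sup>2 + (g x)\<^sup>2)" using assms by simp
  have "\<bar>a * b\<bar> \<le> a\<^sup>2 + b\<^sup>2" for a b :: real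
  proof -
    have "0 \<le> (\<bar>a\<bar> - \<bar>b\<bar>)\<^sup>2" by simp
    then have "2 * (\<bar>a\<bar> * \<bar>b\<bar>) \<le> a\<^sup>2 + b\<^sup>2" by (simp add: power2_diff)
    then show ?thesis unfolding abs_mult using mult_nonneg_nonneg[of "\<bar>a\<bar>" "\<bar>b\<bar>"] by linarith
  qed
  then show "AE x in M. norm (f x * g x) \<le> norm ((f x)\<^sup>2 + (g x)\<^sup>2)"
    by simp
qed simp

text \<open>
  Martingale differences are described without conditional expectations: \<open>d n\<close> is orthogonal
  to every function of the past \<open>F n\<close> with which it has an integrable product.
\<close>

locale L2_martingale_differences = prob_space +
  fixes F :: "nat \<Rightarrow> 'a measure" and d :: "nat \<Rightarrow> 'a \<Rightarrow> real"
  assumes subalg: "\<And>n. subalgebra M (F n)" and filtration: "\<And>n. subalgebra (F (Suc n)) (F n)"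
    and adapted: "\<And>n. d n \<in> borel_measurable (F (Suc n))"
    and square_integrable: "\<And>n. integrable M (\<lambda>\<omega>. (d n \<omega>)\<^sup>2)"
    and orthogonal: "\<And>n g. g \<in> borel_measurable (F n) \<Longrightarrow> integrable M (\<lambda>\<omega>. g \<omega> * d n \<omega>) \<Longrightarrow>
      expectation (\<lambda>\<omega>. g \<omega> * d n \<omega>) = 0"
begin

lemma adapted_later: "k < n \<Longrightarrow> d k \<in> borel_measurable (F n)"
proof (induction n)
  case (Suc n)
  then show ?case
    using adapted[of k] measurable_from_subalg[OF filtration[of n]] by (cases "k = n") auto
qed simp

lemma measurable_d [measurable]: "d n \<in> borel_measurable M"
  by (rule measurable_from_subalg[OF subalg adapted])

lemma sum_square_expectation:
  "integrable M (\<lambda>\<omega>. (\<Sum>k<n. d k \<omega>)\<^sup>2) \<and>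
   expectation (\<lambda>\<omega>. (\<Sum>k<n. d k \<omega>)\<^sup>2) = (\<Sum>k<n. expectation (\<lambda>\<omega>. (d k \<omega>)\<^sup>2))"
proof (induction n)
  case (Suc n)
  let ?S = "\<lambda>\<omega>. \<Sum>k<n. d k \<omega>"
  have S: "?S \<in> borel_measurable (F n)" by (intro borel_measurable_sum adapted_later) auto
  have int: "integrable M (\<lambda>\<omega>. ?S \<omega> * d n \<omega>)"
    by (rule integrable_mult_of_squares) (use Suc square_integrable in auto)
  have eq: "(\<Sum>k<Suc n. d k \<omega>)\<^sup>2 = (?S \<omega>)\<^sup>2 + 2 * (?S \<omega> * d n \<omega>) + (d n \<omega>)\<^sup>2" for \<omega>
    by (simp add: power2_sum)
  show ?case unfolding eq using Suc int square_integrable orthogonal[OF S int] by simp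
qed simp

text \<open>
  Kolmogorov's maximal inequality. The martingale is stopped when it first leaves \<open>(-\<epsilon>, \<epsilon>)\<close>
  after time \<open>m\<close>: the stopped increments are again orthogonal martingale differences, and the
  stopped sum has modulus at least \<open>\<epsilon>\<close> exactly when the original one ever had, so Chebyshev's
  inequality for the stopped sum at the final time suffices.
\<close>

lemma maximal_inequality:
  assumes e: "0 < \<epsilon>"
  shows "prob {\<omega> \<in> space M. \<exists>j\<in>{m..n}. \<epsilon> \<le> \<bar>\<Sum>i=m..<j. d i \<omega>\<bar>}
    \<le> (\<Sum>k=m..<n. expectation (\<lambda>\<omega>. (d k \<omega>)\<^sup>2)) / \<epsilon>\<^sup>2"
proof -
  define T where "T k \<omega> \<longleftrightarrow> m \<le> k \<and> (\<forall>j\<in>{m..k}. \<bar>\<Sum>i=m..<j. d i \<omega>\<bar> < \<epsilon>)" for k \<omega>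
  define c where "c k \<omega> = (if T k \<omega> then d k \<omega> else 0)" for k \<omega>
  have T_meas: "Measurable.pred (F k) (T k)" for k
  proof -
    have "(\<lambda>\<omega>. \<Sum>i=m..<j. d i \<omega>) \<in> borel_measurable (F k)" if "j \<in> {m..k}" for j
      using that by (intro borel_measurable_sum adapted_later) auto
    then show ?thesis unfolding T_def by (intro pred_intros_logic pred_intros_finite) auto
  qed
  have T_meas_Suc: "Measurable.pred (F (Suc k)) (T k)" for k
    using T_meas by (rule measurable_from_subalg[OF filtration])
  interpret c: L2_martingale_differences M F c
  proof
    show c_meas: "c k \<in> borel_measurable (F (Suc k))" for k
      unfolding c_def using T_meas_Suc[of k] adapted[of k] by measurable
    show "integrable M (\<lambda>\<omega>. (c k \<omega>)\<^sup>2)" for k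
    proof (rule Bochner_Integration.integrable_bound[OF square_integrable[of k]])
      show "(\<lambda>\<omega>. (c k \<omega>)\<^sup>2) \<in> borel_measurable M"
        using measurable_from_subalg[OF subalg c_meas, of k] by measurable
    qed (auto simp: c_def)
    show "expectation (\<lambda>\<omega>. g \<omega> * c k \<omega>) = 0"
      if g: "g \<in> borel_measurable (F k)" "integrable M (\<lambda>\<omega>. g \<omega> * c k \<omega>)" for k g
    proof -
      have eq: "g \<omega> * c k \<omega> = (if T k \<omega> then g \<omega> else 0) * d k \<omega>" for \<omega>
        by (simp add: c_def)
      have "(\<lambda>\<omega>. if T k \<omega> then g \<omega> else 0) \<in> borel_measurable (F k)"
        using g(1) T_meas[of k] by measurable
      then show ?thesis using g(2) unfolding eq by (rule orthogonal)
    qed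
  qed (rule subalg filtration)+
  have stop: "\<epsilon> \<le> \<bar>\<Sum>k<n. c k \<omega>\<bar>" if ex: "\<exists>j\<in>{m..n}. \<epsilon> \<le> \<bar>\<Sum>i=m..<j. d i \<omega>\<bar>" for \<omega>
  proof -
    define j where "j = (LEAST j. m \<le> j \<and> \<epsilon> \<le> \<bar>\<Sum>i=m..<j. d i \<omega>\<bar>)"
    obtain j' where j': "j' \<in> {m..n}" "\<epsilon> \<le> \<bar>\<Sum>i=m..<j'. d i \<omega>\<bar>" using ex by blast
    have j: "m \<le> j" "\<epsilon> \<le> \<bar>\<Sum>i=m..<j. d i \<omega>\<bar>"
      using LeastI[of "\<lambda>j. m \<le> j \<and> \<epsilon> \<le> \<bar>\<Sum>i=m..<j. d i \<omega>\<bar>" j'] j' by (auto simp: j_def)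
    have "j \<le> n"
      using Least_le[of "\<lambda>j. m \<le> j \<and> \<epsilon> \<le> \<bar>\<Sum>i=m..<j. d i \<omega>\<bar>" j'] j' by (auto simp: j_def)
    have before: "\<bar>\<Sum>i=m..<i. d i \<omega>\<bar> < \<epsilon>" if "m \<le> i" "i < j" for i
      using not_less_Least[of i "\<lambda>j. m \<le> j \<and> \<epsilon> \<le> \<bar>\<Sum>i=m..<j. d i \<omega>\<bar>"] that
      by (auto simp: j_def)
    have c_eq: "c k \<omega> = (if k \<in> {m..<j} then d k \<omega> else 0)" for k
    proof (cases "k \<in> {m..<j}")
      case True
      then have "T k \<omega>" using before by (auto simp: T_def)
      with True show ?thesis by (simp add: c_def)
    next
      case False
      then have "\<not> T k \<omega>" using j by (force simp: T_def)
      with False show ?thesis by (simp only: c_def if_False)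
    qed
    have "{..<n} \<inter> {m..<j} = {m..<j}" using \<open>j \<le> n\<close> by auto
    then have "(\<Sum>k<n. c k \<omega>) = (\<Sum>i=m..<j. d i \<omega>)"
      unfolding c_eq by (subst sum.inter_restrict[symmetric]) simp_all
    then show ?thesis using j(2) by simp
  qed
  have "prob {\<omega> \<in> space M. \<exists>j\<in>{m..n}. \<epsilon> \<le> \<bar>\<Sum>i=m..<j. d i \<omega>\<bar>}
    \<le> prob {\<omega> \<in> space M. \<epsilon> \<le> \<bar>\<Sum>k<n. c k \<omega>\<bar>}"
    using stop by (intro finite_measure_mono) auto
  also have "\<dots> \<le> expectation (\<lambda>\<omega>. (\<Sum>k<n. c k \<omega>)\<^sup>2) / \<epsilon>\<^sup>2"
    using c.sum_square_expectation[of n] e by (intro second_moment_method) auto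
  also have "\<dots> = (\<Sum>k<n. expectation (\<lambda>\<omega>. (c k \<omega>)\<^sup>2)) / \<epsilon>\<^sup>2"
    using c.sum_square_expectation[of n] by simp
  also have "\<dots> \<le> (\<Sum>k<n. if k \<in> {m..<n} then expectation (\<lambda>\<omega>. (d k \<omega>)\<^sup>2) else 0) / \<epsilon>\<^sup>2"
  proof (intro divide_right_mono sum_mono)
    fix k
    show "expectation (\<lambda>\<omega>. (c k \<omega>)\<^sup>2) \<le>
      (if k \<in> {m..<n} then expectation (\<lambda>\<omega>. (d k \<omega>)\<^sup>2) else 0)" if "k \<in> {..<n}"
    proof (cases "m \<le> k")
      case True
      then show ?thesis using that c.square_integrable square_integrable
        by (auto intro!: integral_mono simp: c_def)
    next
      case False
      then show ?thesis by (simp add: c_def T_def)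
    qed
  qed simp
  also have "(\<Sum>k<n. if k \<in> {m..<n} then expectation (\<lambda>\<omega>. (d k \<omega>)\<^sup>2) else 0)
    = (\<Sum>k=m..<n. expectation (\<lambda>\<omega>. (d k \<omega>)\<^sup>2))"
    by (subst sum.inter_restrict[symmetric], simp, rule sum.cong) auto
  finally show ?thesis .
qed

theorem AE_summable:
  assumes summable: "summable (\<lambda>n. expectation (\<lambda>\<omega>. (d n \<omega>)\<^sup>2))"
  shows "AE \<omega> in M. summable (\<lambda>n. d n \<omega>)"
proof -
  let ?v = "\<lambda>n. expectation (\<lambda>\<omega>. (d n \<omega>)\<^sup>2)"
  have ev: "AE \<omega> in M. \<exists>m. \<forall>j\<ge>m. \<bar>\<Sum>i=m..<j. d i \<omega>\<bar> < \<epsilon>" if e: "0 < \<epsilon>" for \<epsilon>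
  proof -
    let ?B = "\<lambda>m n. {\<omega> \<in> space M. \<exists>j\<in>{m..n}. \<epsilon> \<le> \<bar>\<Sum>i=m..<j. d i \<omega>\<bar>}"
    let ?C = "{\<omega> \<in> space M. \<forall>m. \<exists>j\<ge>m. \<epsilon> \<le> \<bar>\<Sum>i=m..<j. d i \<omega>\<bar>}"
    have [measurable]: "?C \<in> sets M" "?B m n \<in> sets M" for m n by measurable
    have bound: "prob ?C \<le> (\<Sum>k. ?v (k + m)) / \<epsilon>\<^sup>2" for m
    proof -
      have "(\<lambda>n. prob (?B m n)) \<longlonglongrightarrow> prob (\<Union>n. ?B m n)"
        by (rule finite_Lim_measure_incseq) (auto simp: incseq_def)
      moreover have "prob (?B m n) \<le> (\<Sum>k. ?v (k + m)) / \<epsilon>\<^sup>2" for n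
      proof -
        have "(\<Sum>k=m..<n. ?v k) = (\<Sum>k<n - m. ?v (k + m))"
          by (rule sum.reindex_bij_witness[of _ "\<lambda>k. k + m" "\<lambda>k. k - m"]) auto
        also have "\<dots> \<le> (\<Sum>k. ?v (k + m))"
          using summable by (intro sum_le_suminf summable_ignore_initial_segment) auto
        finally show ?thesis
          using maximal_inequality[OF e, of m n] e
          by (meson divide_right_mono order_trans zero_le_power2)
      qed
      ultimately have "prob (\<Union>n. ?B m n) \<le> (\<Sum>k. ?v (k + m)) / \<epsilon>\<^sup>2"
        by (intro LIMSEQ_le_const2) auto
      moreover have "prob ?C \<le> prob (\<Union>n. ?B m n)"
        by (intro finite_measure_mono) (auto, meson atLeastAtMost_iff order_refl)
      ultimately show ?thesis by linarith
    qed
    have "(\<lambda>m. (\<Sum>k. ?v (k + m)) / \<epsilon>\<^sup>2) \<longlonglongrightarrow> 0 / \<epsilon>\<^sup>2"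
      using suminf_exist_split2[OF summable] by (intro tendsto_intros) (use e in auto)
    then have "prob ?C \<le> 0"
      using bound by (intro LIMSEQ_le_const) auto
    then have "prob ?C = 0" using measure_nonneg[of M ?C] by linarith
    then have "AE \<omega> in M. \<omega> \<notin> ?C" using prob_eq_0[of ?C] by simp
    then show ?thesis by (rule AE_mp) (intro AE_I2 impI, simp add: not_le, metis not_le)
  qed
  have "AE \<omega> in M. \<forall>p. \<exists>m. \<forall>j\<ge>m. \<bar>\<Sum>i=m..<j. d i \<omega>\<bar> < inverse (real (Suc p))"
    unfolding AE_all_countable by (intro allI ev) simp
  then show ?thesis
  proof (rule AE_mp, intro AE_I2 impI)
    fix \<omega> assume *: "\<forall>p. \<exists>m. \<forall>j\<ge>m. \<bar>\<Sum>i=m..<j. d i \<omega>\<bar> < inverse (real (Suc p))"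
    show "summable (\<lambda>n. d n \<omega>)"
      unfolding summable_Cauchy
    proof (intro allI impI)
      fix e :: real assume "0 < e"
      then obtain p where p: "inverse (real (Suc p)) < e / 2"
        using reals_Archimedean[of "e / 2"] by auto
      obtain m where m: "\<And>j. m \<le> j \<Longrightarrow> \<bar>\<Sum>i=m..<j. d i \<omega>\<bar> < e / 2"
        using * p by (meson order.strict_trans)
      show "\<exists>N. \<forall>k\<ge>N. \<forall>n. norm (\<Sum>i=k..<n. d i \<omega>) < e"
      proof (intro exI[of _ m] allI impI)
        fix k n assume k: "m \<le> k"
        show "norm (\<Sum>i=k..<n. d i \<omega>) < e"
        proof (cases "k \<le> n")
          case True
          have "(\<Sum>i=m..<k. d i \<omega>) + (\<Sum>i=k..<n. d i \<omega>) = (\<Sum>i=m..<n. d i \<omega>)"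
            using k True by (rule sum.atLeastLessThan_concat)
          then show ?thesis using m[OF k] m[of n] k True by simp
        qed (use \<open>0 < e\<close> in simp)
      qed
    qed
  qed
qed

end

section \<open>Independent draws and the filtration they generate\<close>

definition history :: "'w measure \<Rightarrow> 'e measure \<Rightarrow> (nat \<Rightarrow> 'w \<Rightarrow> 'e) \<Rightarrow> nat \<Rightarrow> 'w measure" where
  "history P M \<xi> n = sigma (space P) (\<Union>i\<in>{1..n}. {\<xi> i -` B \<inter> space P | B. B \<in> sets M})"

locale iid_draws = P: prob_space P + M: prob_space M for P :: "'w measure" and M :: "'e measure" +
  fixes \<xi> :: "nat \<Rightarrow> 'w \<Rightarrow> 'e"
  assumes xi_meas: "\<And>n. 1 \<le> n \<Longrightarrow> \<xi> n \<in> measurable P M"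
    and xi_distr: "\<And>n. 1 \<le> n \<Longrightarrow> distr P M (\<xi> n) = M"
    and xi_indep: "P.indep_vars (\<lambda>_. M) \<xi> {1..}"
begin

abbreviation "H \<equiv> history P M \<xi>"

lemma space_H [simp]: "space (H n) = space P"
  by (simp add: history_def space_measure_of_conv)

lemma sets_H: "sets (H n) = sigma_sets (space P) (\<Union>i\<in>{1..n}. {\<xi> i -` B \<inter> space P | B. B \<in> sets M})"
  unfolding history_def by (rule sets_measure_of) auto

lemma subalgebra_H: "subalgebra P (H n)"
proof -
  have "(\<Union>i\<in>{1..n}. {\<xi> i -` B \<inter> space P | B. B \<in> sets M}) \<subseteq> sets P"
    using xi_meas by (auto intro: measurable_sets)
  then show ?thesis
    by (simp only: subalgebra_def sets_H space_H sets.sigma_sets_subset simp_thms)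
qed

lemma subalgebra_H_Suc: "subalgebra (H (Suc n)) (H n)"
proof -
  have "(\<Union>i\<in>{1..n}. {\<xi> i -` B \<inter> space P | B. B \<in> sets M})
    \<subseteq> (\<Union>i\<in>{1..Suc n}. {\<xi> i -` B \<inter> space P | B. B \<in> sets M})"
    by (intro UN_mono) auto
  then show ?thesis
    by (simp only: subalgebra_def sets_H space_H sigma_sets_mono' simp_thms)
qed

lemma measurable_xi_H: "\<xi> (Suc n) \<in> measurable (H (Suc n)) M"
proof (rule measurableI)
  fix B assume "B \<in> sets M"
  then show "\<xi> (Suc n) -` B \<inter> space (H (Suc n)) \<in> sets (H (Suc n))"
    unfolding sets_H space_H by (intro sigma_sets.Basic UN_I[of "Suc n"]) auto
qed (use xi_meas[of "Suc n", THEN measurable_space] in simp)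

lemma measurable_id_H: "(\<lambda>\<omega>. \<omega>) \<in> measurable P (H n)"
  using measurable_from_subalg[OF subalgebra_H, of "\<lambda>\<omega>. \<omega>" n "H n"] by simp

lemma indep_next_draw: "P.indep_set (sets (H n)) {\<xi> (Suc n) -` B \<inter> space P | B. B \<in> sets M}"
proof -
  let ?E = "\<lambda>i. {\<xi> i -` B \<inter> space P | B. B \<in> sets M}"
  let ?I = "case_bool {1..n} {Suc n}"
  have "P.indep_sets ?E {1..}" using xi_indep by (simp add: P.indep_vars_def2)
  then have "P.indep_sets ?E (\<Union>j\<in>UNIV. ?I j)"
    by (rule P.indep_sets_mono_index[rotated]) (auto simp: UNIV_bool)
  then have "P.indep_sets (\<lambda>j. sigma_sets (space P) (\<Union>i\<in>?I j. ?E i)) UNIV"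
  proof (rule P.indep_sets_collect_sigma)
    show "Int_stable (?E i)" for i
    proof (rule Int_stableI)
      fix a b assume "a \<in> ?E i" "b \<in> ?E i"
      then obtain A B where "A \<in> sets M" "B \<in> sets M" "a = \<xi> i -` A \<inter> space P" "b = \<xi> i -` B \<inter> space P"
        by auto
      then show "a \<inter> b \<in> ?E i" by (intro CollectI exI[of _ "A \<inter> B"]) auto
    qed
    show "disjoint_family_on ?I UNIV"
      by (auto simp: disjoint_family_on_def split: bool.splits)
  qed
  moreover have "(\<lambda>j. sigma_sets (space P) (\<Union>i\<in>?I j. ?E i)) = case_bool (sets (H n)) (sigma_sets (space P) (?E (Suc n)))"
    by (auto simp: fun_eq_iff sets_H split: bool.splits)
  ultimately have "P.indep_set (sets (H n)) (sigma_sets (space P) (?E (Suc n)))"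
    by (simp add: P.indep_set_def)
  then show ?thesis
    unfolding P.indep_sets2_eq by blast
qed

lemma measurable_pair_xi: "(\<lambda>\<omega>. (\<omega>, \<xi> (Suc n) \<omega>)) \<in> measurable P (H n \<Otimes>\<^sub>M M)"
  using measurable_id_H xi_meas[of "Suc n"] by (intro measurable_Pair) auto

text \<open>
  The identity map into the space of past events is independent of the next draw. Using it in
  place of the vector of past draws makes the freezing rules below apply directly to any function
  that is measurable with respect to the past.
\<close>

lemma joint_distr:
  "distr P (H n \<Otimes>\<^sub>M M) (\<lambda>\<omega>. (\<omega>, \<xi> (Suc n) \<omega>)) = distr P (H n) (\<lambda>\<omega>. \<omega>) \<Otimes>\<^sub>M M"
proof (rule pair_measure_eqI[symmetric])
  interpret D: prob_space "distr P (H n) (\<lambda>\<omega>. \<omega>)" by (rule P.prob_space_distr[OF measurable_id_H])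
  show "sigma_finite_measure (distr P (H n) (\<lambda>\<omega>. \<omega>))" "sigma_finite_measure M" ..
  show "sets (distr P (H n) (\<lambda>\<omega>. \<omega>) \<Otimes>\<^sub>M M) = sets (distr P (H n \<Otimes>\<^sub>M M) (\<lambda>\<omega>. (\<omega>, \<xi> (Suc n) \<omega>)))"
    by (simp cong: sets_pair_measure_cong)
  fix A B assume A: "A \<in> sets (distr P (H n) (\<lambda>\<omega>. \<omega>))" and B: "B \<in> sets M"
  let ?B = "\<xi> (Suc n) -` B \<inter> space P"
  have A': "A \<in> sets (H n)" "A \<inter> space P = A" using A sets.sets_into_space[of A "H n"] by auto
  have "emeasure P (A \<inter> ?B) = emeasure P A * emeasure P ?B"
  proof -
    have "P.prob (A \<inter> ?B) = P.prob A * P.prob ?B"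
      using indep_next_draw[of n] A' B unfolding P.indep_sets2_eq by blast
    then show ?thesis by (simp add: P.emeasure_eq_measure ennreal_mult)
  qed
  moreover have "emeasure P ?B = emeasure M B"
    using emeasure_distr[OF xi_meas[of "Suc n"] B] xi_distr[of "Suc n"] by simp
  moreover have "(\<lambda>\<omega>. (\<omega>, \<xi> (Suc n) \<omega>)) -` (A \<times> B) \<inter> space P = A \<inter> ?B" using A' by auto
  ultimately show "emeasure (distr P (H n) (\<lambda>\<omega>. \<omega>)) A * emeasure M B =
    emeasure (distr P (H n \<Otimes>\<^sub>M M) (\<lambda>\<omega>. (\<omega>, \<xi> (Suc n) \<omega>))) (A \<times> B)"
    using A' B by (simp add: emeasure_distr measurable_id_H measurable_pair_xi)
qed

text \<open>Freezing: the draw \<open>\<xi> (Suc n)\<close> may be integrated out with the past held fixed.\<close>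

lemma nn_integral_freeze:
  assumes f [measurable]: "f \<in> borel_measurable (H n \<Otimes>\<^sub>M M)"
  shows "(\<integral>\<^sup>+\<omega>. f (\<omega>, \<xi> (Suc n) \<omega>) \<partial>P) = (\<integral>\<^sup>+\<omega>. (\<integral>\<^sup>+s. f (\<omega>, s) \<partial>M) \<partial>P)"
proof -
  let ?D = "distr P (H n) (\<lambda>\<omega>. \<omega>)"
  have f': "f \<in> borel_measurable (?D \<Otimes>\<^sub>M M)"
    using f by (simp cong: measurable_cong_sets sets_pair_measure_cong)
  have "(\<integral>\<^sup>+\<omega>. f (\<omega>, \<xi> (Suc n) \<omega>) \<partial>P) = (\<integral>\<^sup>+x. f x \<partial>(?D \<Otimes>\<^sub>M M))"
    unfolding joint_distr[symmetric] using f by (subst nn_integral_distr[OF measurable_pair_xi]) simp_all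
  also have "\<dots> = (\<integral>\<^sup>+\<omega>. (\<integral>\<^sup>+s. f (\<omega>, s) \<partial>M) \<partial>?D)"
    by (rule M.nn_integral_fst[OF f', symmetric])
  also have "\<dots> = (\<integral>\<^sup>+\<omega>. (\<integral>\<^sup>+s. f (\<omega>, s) \<partial>M) \<partial>P)"
    using M.borel_measurable_nn_integral_fst[OF f] by (subst nn_integral_distr[OF measurable_id_H]) simp_all
  finally show ?thesis .
qed

lemma expectation_freeze_zero:
  fixes f :: "'w \<times> 'e \<Rightarrow> real"
  assumes f [measurable]: "f \<in> borel_measurable (H n \<Otimes>\<^sub>M M)"
    and int: "integrable P (\<lambda>\<omega>. f (\<omega>, \<xi> (Suc n) \<omega>))"
    and zero: "\<And>\<omega>. \<omega> \<in> space P \<Longrightarrow> (\<integral>s. f (\<omega>, s) \<partial>M) = 0"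
  shows "(\<integral>\<omega>. f (\<omega>, \<xi> (Suc n) \<omega>) \<partial>P) = 0"
proof -
  let ?D = "distr P (H n) (\<lambda>\<omega>. \<omega>)"
  interpret D: prob_space ?D by (rule P.prob_space_distr[OF measurable_id_H])
  interpret DM: pair_sigma_finite ?D M ..
  have "integrable (?D \<Otimes>\<^sub>M M) f"
    unfolding joint_distr[symmetric] using int by (subst integrable_distr_eq[OF measurable_pair_xi f])
  then have "(\<integral>\<omega>. (\<integral>s. f (\<omega>, s) \<partial>M) \<partial>?D) = (\<integral>x. f x \<partial>(?D \<Otimes>\<^sub>M M))"
    by (rule DM.integral_fst')
  moreover have "(\<integral>x. f x \<partial>(?D \<Otimes>\<^sub>M M)) = (\<integral>\<omega>. f (\<omega>, \<xi> (Suc n) \<omega>) \<partial>P)"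
    unfolding joint_distr[symmetric] by (rule integral_distr[OF measurable_pair_xi f])
  moreover have "(\<integral>\<omega>. (\<integral>s. f (\<omega>, s) \<partial>M) \<partial>?D) = (\<integral>\<omega>. 0 \<partial>?D)"
    using zero by (intro Bochner_Integration.integral_cong) auto
  ultimately show ?thesis by simp
qed

lemma AE_xi:
  assumes "AE s in M. Q s"
  shows "AE \<omega> in P. \<forall>n. Q (\<xi> (Suc n) \<omega>)"
  unfolding AE_all_countable
proof
  fix n
  have "AE s in distr P M (\<xi> (Suc n)). Q s" using assms by (subst xi_distr) simp_all
  then show "AE \<omega> in P. Q (\<xi> (Suc n) \<omega>)"
    by (rule AE_distrD[OF xi_meas, rotated]) simp
qed

end

section \<open>Pointwise estimates for one proximal step\<close>

text \<open>
  The pairing of \<open>u\<close> is moved from the new point, where monotonicity gives it, to the old point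
  \<open>x\<close>, where a fresh draw makes it centred. The correction is absorbed by half of the squared
  increment that the expansion leaves over.
\<close>

lemma proximal_step_estimate:
  fixes B :: "'h::{real_inner, banach} \<Rightarrow> 'h set"
  assumes B: "maximal_monotone B" and r: "0 < r" and u: "u \<in> B z"
  shows "(norm (resolvent r B x - z))\<^sup>2 + r\<^sup>2 / 2 * (norm (yosida r B x))\<^sup>2
    \<le> (norm (x - z))\<^sup>2 - 2 * r * (u \<bullet> (x - z)) + 2 * r\<^sup>2 * (norm u)\<^sup>2"
proof -
  define j where "j = resolvent r B x - z"
  define y where "y = yosida r B x"
  have x: "x - z = j + r *\<^sub>R y"
    using resolvent_decomp[of r x B] r by (simp add: j_def y_def algebra_simps)
  have "0 \<le> j \<bullet> (y - u)"
    unfolding j_def y_def by (rule maximal_monotoneD_mono[OF B yosida_mem[OF B r] u])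
  then have *: "0 \<le> r * (j \<bullet> (y - u))" using r by simp
  have "0 \<le> r\<^sup>2 * (norm (y - 2 *\<^sub>R u))\<^sup>2" by simp
  then have **: "0 \<le> r\<^sup>2 * (norm y)\<^sup>2 - 4 * r\<^sup>2 * (u \<bullet> y) + 4 * r\<^sup>2 * (norm u)\<^sup>2"
    unfolding power2_norm_eq_inner by (simp add: inner_simps inner_commute algebra_simps)
  have "(norm (x - z))\<^sup>2 = (norm j)\<^sup>2 + 2 * r * (j \<bullet> y) + r\<^sup>2 * (norm y)\<^sup>2"
    unfolding x by (rule norm_add_scaleR_sq)
  moreover have "u \<bullet> (x - z) = j \<bullet> u + r * (u \<bullet> y)"
    unfolding x by (simp add: inner_simps inner_commute)
  ultimately show ?thesis
    using * ** unfolding j_def[symmetric] y_def[symmetric]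
    by (simp add: inner_simps algebra_simps power2_eq_square)
qed

text \<open>
  Monotonicity controls the pairing \<open>(yosida r B w - u) \<bullet> (w - x)\<close> only up to an error of order
  \<open>r * (norm u)\<^sup>2\<close>, which is useless when \<open>u\<close> is large. Beyond a threshold \<open>c\<close> the pairing is
  therefore bounded trivially, at the cost of the two truncated terms, which become small after
  integration when they run through uniformly integrable families.
\<close>

lemma yosida_pairing_lower_bound:
  fixes B :: "'h::{real_inner, banach} \<Rightarrow> 'h set"
  assumes B: "maximal_monotone B" and r: "0 < r" and u: "u \<in> B x"
    and R: "norm (w - x) \<le> R" and N: "norm (yosida r B w) \<le> N" and b: "0 \<le> b" "b \<le> c"
  shows "- (r * c\<^sup>2) - R * ((if b < N then N else 0) + 2 * (if c < norm u then norm u else 0))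
    \<le> (yosida r B w - u) \<bullet> (w - x)"
proof -
  let ?y = "yosida r B w"
  have R0: "0 \<le> R" using R norm_ge_zero order_trans by blast
  have N0: "0 \<le> N" using N norm_ge_zero order_trans by blast
  show ?thesis
  proof (cases "c < norm u")
    case False
    have eq: "w - x = (resolvent r B w - x) + r *\<^sub>R ?y"
      using resolvent_decomp[of r w B] r by (simp add: algebra_simps)
    have "0 \<le> (resolvent r B w - x) \<bullet> (?y - u)"
      by (rule maximal_monotoneD_mono[OF B yosida_mem[OF B r] u])
    then have "r * ((?y - u) \<bullet> ?y) \<le> (?y - u) \<bullet> (w - x)"
      unfolding eq by (simp add: inner_add_right inner_commute)
    moreover have "- (c\<^sup>2) \<le> (?y - u) \<bullet> ?y"
    proof -
      have "0 \<le> (norm (2 *\<^sub>R ?y - u))\<^sup>2" by simp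
      then have "- ((norm u)\<^sup>2) \<le> 4 * ((?y - u) \<bullet> ?y)"
        unfolding power2_norm_eq_inner by (simp add: inner_simps inner_commute)
      moreover have "(norm u)\<^sup>2 \<le> c\<^sup>2" using False by (intro power_mono) auto
      moreover have "0 \<le> c\<^sup>2" by simp
      ultimately show ?thesis by linarith
    qed
    then have "- (r * c\<^sup>2) \<le> r * ((?y - u) \<bullet> ?y)"
      using r mult_left_mono[of "- (c\<^sup>2)" "(?y - u) \<bullet> ?y" r] by simp
    moreover have "0 \<le> R * (if b < N then N else 0)" using R0 N0 by simp
    ultimately show ?thesis using False by simp
  next
    case True
    have "\<bar>(?y - u) \<bullet> (w - x)\<bar> \<le> norm (?y - u) * norm (w - x)" by (rule Cauchy_Schwarz_ineq2)
    also have "\<dots> \<le> (N + norm u) * R"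
      using norm_triangle_ineq4[of ?y u] N R N0 by (intro mult_mono) auto
    also have "\<dots> \<le> ((if b < N then N else 0) + 2 * norm u) * R"
      using True b R0 by (intro mult_right_mono) auto
    finally have "- (R * ((if b < N then N else 0) + 2 * norm u)) \<le> (?y - u) \<bullet> (w - x)"
      by (simp add: mult.commute)
    moreover have "0 \<le> r * c\<^sup>2" using r by simp
    ultimately show ?thesis using True by simp
  qed
qed

lemma yosida_lipschitz:
  fixes B :: "'h::{real_inner, banach} \<Rightarrow> 'h set"
  assumes B: "maximal_monotone B" and r: "0 < r"
  shows "norm (yosida r B x - yosida r B y) \<le> 2 * norm (x - y) / r"
proof -
  have "yosida r B x - yosida r B y = ((x - y) - (resolvent r B x - resolvent r B y)) /\<^sub>R r"
    by (simp add: yosida_def algebra_simps)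
  then have "norm (yosida r B x - yosida r B y) = norm ((x - y) - (resolvent r B x - resolvent r B y)) / r"
    using r by (simp add: divide_inverse mult.commute)
  also have "\<dots> \<le> (norm (x - y) + norm (resolvent r B x - resolvent r B y)) / r"
    using r by (intro divide_right_mono norm_triangle_ineq4) auto
  also have "\<dots> \<le> 2 * norm (x - y) / r"
    using r resolvent_nonexpansive[OF B r, of x y] by (intro divide_right_mono) auto
  finally show ?thesis .
qed

section \<open>Auxiliary facts on convergence and measurability\<close>

lemma almost_decreasing_convergent:
  fixes u e :: "nat \<Rightarrow> real"
  assumes step: "\<And>n. u (Suc n) \<le> u n + e n" and nonneg: "\<And>n. 0 \<le> u n" and e: "summable e"
  shows "convergent u"
proof -
  let ?w = "\<lambda>n. u n - (\<Sum>k<n. e k)"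
  obtain K where K: "\<And>n. \<bar>\<Sum>k<n. e k\<bar> \<le> K"
    using convergent_imp_Bseq[OF summable_iff_convergent[THEN iffD1, OF e]] by (auto simp: Bseq_def)
  have "convergent ?w"
  proof (rule Bseq_monoseq_convergent)
    have dec: "decseq ?w"
      by (rule decseq_SucI) (use step in \<open>simp add: algebra_simps\<close>)
    then show "monoseq ?w" by (rule decseq_imp_monoseq)
    have "- K \<le> ?w n" for n
      using K[of n] nonneg[of n] by linarith
    moreover have "?w n \<le> ?w 0" for n using decseqD[OF dec, of 0 n] by simp
    ultimately show "Bseq ?w" by (intro BseqI'[where K = "max K \<bar>?w 0\<bar>"]) (unfold real_norm_def, smt (verit))
  qed
  then have "convergent (\<lambda>n. ?w n + (\<Sum>k<n. e k))"
    by (rule convergent_add) (rule summable_iff_convergent[THEN iffD1, OF e])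
  then show ?thesis by simp
qed

lemma AE_summable_if_nn_integral_le:
  fixes f :: "nat \<Rightarrow> 'a \<Rightarrow> real"
  assumes f [measurable]: "\<And>n. f n \<in> borel_measurable M" and nonneg: "\<And>n x. 0 \<le> f n x"
    and le: "\<And>n. (\<integral>\<^sup>+x. ennreal (f n x) \<partial>M) \<le> ennreal (c n)"
    and c: "summable c" "\<And>n. 0 \<le> c n"
  shows "AE x in M. summable (\<lambda>n. f n x)"
proof -
  have "(\<integral>\<^sup>+x. (\<Sum>n. ennreal (f n x)) \<partial>M) = (\<Sum>n. \<integral>\<^sup>+x. ennreal (f n x) \<partial>M)"
    by (intro nn_integral_suminf) simp
  also have "\<dots> \<le> (\<Sum>n. ennreal (c n))" by (intro suminf_le le) auto
  also have "\<dots> = ennreal (\<Sum>n. c n)" using c by (intro suminf_ennreal2) auto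
  also have "\<dots> < \<infinity>" by simp
  finally have "AE x in M. (\<Sum>n. ennreal (f n x)) \<noteq> \<infinity>"
    by (intro nn_integral_PInf_AE) auto
  then show ?thesis
    by (rule AE_mp) (intro AE_I2 impI summable_suminf_not_top nonneg, simp)
qed

text \<open>
  Functions that are measurable in one variable and continuous in the other are jointly
  measurable: replace the second variable by the first element of a dense sequence within
  distance \<open>1 / (n + 1)\<close>, and let \<open>n\<close> tend to infinity.
\<close>

lemma caratheodory_function_measurable:
  fixes f :: "'e \<Rightarrow> 'a::{metric_space, second_countable_topology} \<Rightarrow> 'b::metric_space"
  assumes meas: "\<And>x. (\<lambda>s. f s x) \<in> borel_measurable M"
    and cont: "\<And>s. continuous_on UNIV (f s)"
  shows "(\<lambda>p. f (fst p) (snd p)) \<in> borel_measurable (M \<Otimes>\<^sub>M borel)"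
proof -
  obtain D :: "'a set" where D: "countable D" "\<And>U. open U \<Longrightarrow> U \<noteq> {} \<Longrightarrow> \<exists>d\<in>D. d \<in> U"
    by (rule countable_dense_setE) blast
  have "D \<noteq> {}" using D(2)[of UNIV] by auto
  define d where "d = from_nat_into D"
  have range_d: "range d = D"
    unfolding d_def by (rule range_from_nat_into) fact+
  define k where "k n x = (LEAST i. dist (d i) x < inverse (real (Suc n)))" for n x
  have k: "dist (d (k n x)) x < inverse (real (Suc n))" for n x
  proof -
    have "\<exists>i. dist (d i) x < inverse (real (Suc n))"
      using D(2)[of "ball x (inverse (real (Suc n)))"] range_d by (auto simp: dist_commute)
    then show ?thesis unfolding k_def by (rule LeastI_ex)
  qed
  show ?thesis
  proof (rule borel_measurable_LIMSEQ_metric)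
    fix n
    have k_meas: "(\<lambda>p :: 'e \<times> 'a. k n (snd p)) \<in> measurable (M \<Otimes>\<^sub>M borel) (count_space UNIV)"
      unfolding k_def by measurable
    have "(\<lambda>p :: 'e \<times> 'a. f (fst p) (d i)) \<in> borel_measurable (M \<Otimes>\<^sub>M borel)" for i
      by (rule measurable_compose[OF measurable_fst meas])
    then show "(\<lambda>p :: 'e \<times> 'a. f (fst p) (d (k n (snd p)))) \<in> borel_measurable (M \<Otimes>\<^sub>M borel)"
      by (rule measurable_compose_countable[where f = "\<lambda>i p. f (fst p) (d i)"]) (rule k_meas)
  next
    fix p :: "'e \<times> 'a"
    have "(\<lambda>n. d (k n (snd p))) \<longlonglongrightarrow> snd p"
    proof (rule metric_LIMSEQ_I)
      fix e :: real assume "0 < e"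
      then obtain N where N: "inverse (real (Suc N)) < e" using reals_Archimedean by blast
      have "dist (d (k n (snd p))) (snd p) < e" if "N \<le> n" for n
      proof -
        have "inverse (real (Suc n)) \<le> inverse (real (Suc N))"
          using that by (intro le_imp_inverse_le) auto
        then show ?thesis using k[of n "snd p"] N by linarith
      qed
      then show "\<exists>N. \<forall>n\<ge>N. dist (d (k n (snd p))) (snd p) < e" by blast
    qed
    then show "(\<lambda>n. f (fst p) (d (k n (snd p)))) \<longlonglongrightarrow> f (fst p) (snd p)"
      using cont[of "fst p"]
      by (intro isCont_tendsto_compose[where g = "f (fst p)"]) (auto simp: continuous_on_eq_continuous_at)
  qed
qed

lemma (in finite_measure) selections_props:
  assumes "\<phi> \<in> selections M A p x" "1 \<le> p"
  shows "\<phi> \<in> borel_measurable M" "AE s in M. \<phi> s \<in> A s x" "integrable M \<phi>"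
    "p = 2 \<Longrightarrow> integrable M (\<lambda>s. (norm (\<phi> s))\<^sup>2)"
proof -
  show meas [measurable]: "\<phi> \<in> borel_measurable M" and "AE s in M. \<phi> s \<in> A s x"
    using assms by (auto simp: selections_def)
  have fin: "(\<integral>\<^sup>+s. ennreal (norm (\<phi> s) powr p) \<partial>M) < \<infinity>"
    using assms by (auto simp: selections_def)
  then have int: "integrable M (\<lambda>s. norm (\<phi> s) powr p)"
    by (intro integrableI_bounded) auto
  show "integrable M \<phi>"
  proof (rule Bochner_Integration.integrable_bound)
    show "integrable M (\<lambda>s. 1 + norm (\<phi> s) powr p)" using int by simp
    have "norm (\<phi> s) \<le> 1 + norm (\<phi> s) powr p" for s
    proof (cases "norm (\<phi> s) \<le> 1")
      case True
      then show ?thesis by (smt (verit) powr_ge_zero)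
    next
      case False
      then have "norm (\<phi> s) powr 1 \<le> norm (\<phi> s) powr p" using assms(2) by (intro powr_mono) auto
      then show ?thesis by simp
    qed
    then show "AE s in M. norm (\<phi> s) \<le> norm (1 + norm (\<phi> s) powr p)"
      by (smt (verit) AE_I2 powr_ge_zero real_norm_def)
  qed simp
  show "integrable M (\<lambda>s. (norm (\<phi> s))\<^sup>2)" if "p = 2"
    using int that by (simp add: powr_numeral)
qed

section \<open>The stochastic proximal iteration\<close>

locale stochastic_prox = iid_draws P M \<xi>
  for P :: "'w measure" and M :: "'e measure" and \<xi> :: "nat \<Rightarrow> 'w \<Rightarrow> 'e" +
  fixes A :: "'e \<Rightarrow> 'h \<Rightarrow> 'h::{real_inner, banach, second_countable_topology} set"
    and l :: "nat \<Rightarrow> real" and x0 :: 'h and D :: "'h set"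
  assumes max_mono: "\<And>s. maximal_monotone (A s)"
    and dom: "\<And>s. dom_op (A s) = D"
    and resolvent_meas: "\<And>r x. 0 < r \<Longrightarrow> (\<lambda>s. resolvent r (A s) x) \<in> borel_measurable M"
    and step_pos: "\<And>n. 0 < l n"
    and step_sum: "filterlim (\<lambda>n. \<Sum>k<n. l k) at_top sequentially"
    and step_sq: "summable (\<lambda>n. (l n)\<^sup>2)"
    and mean_max: "maximal_monotone (mean_op M A)"
    and zer_nonempty: "zer (mean_op M A) \<noteq> {}"
    and zer_sub: "zer (mean_op M A) \<subseteq> zer_sel M A 2"
    and unif_int: "\<And>K :: 'h set. bounded K \<Longrightarrow>
      uniformly_integrable_family M (K \<inter> D) (\<lambda>x s. norm (least_norm_sel (A s) x))"
begin

abbreviation X :: "nat \<Rightarrow> 'w \<Rightarrow> 'h" where "X \<equiv> prox_seq A l \<xi> x0"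

abbreviation Y :: "nat \<Rightarrow> 'e \<Rightarrow> 'h \<Rightarrow> 'h" where "Y n s x \<equiv> yosida (l n) (A s) x"

definition mean_Y :: "nat \<Rightarrow> 'h \<Rightarrow> 'h" where "mean_Y n x = (\<integral>s. Y n s x \<partial>M)"

lemma X_Suc_decomp: "X n \<omega> = X (Suc n) \<omega> + l n *\<^sub>R Y n (\<xi> (Suc n) \<omega>) (X n \<omega>)"
  using resolvent_decomp[of "l n" "X n \<omega>" "A (\<xi> (Suc n) \<omega>)"] step_pos[of n] by simp

lemma X_in_D: "1 \<le> n \<Longrightarrow> X n \<omega> \<in> D"
  by (cases n) (auto intro: resolvent_in_dom[OF max_mono step_pos, unfolded dom])

lemma measurable_resolvent: "(\<lambda>p. resolvent (l n) (A (fst p)) (snd p)) \<in> borel_measurable (M \<Otimes>\<^sub>M borel)"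
proof (rule caratheodory_function_measurable)
  show "(\<lambda>s. resolvent (l n) (A s) x) \<in> borel_measurable M" for x
    by (rule resolvent_meas[OF step_pos])
  show "continuous_on UNIV (resolvent (l n) (A s))" for s
  proof (rule continuous_onI)
    fix x y :: 'h and e :: real assume "0 < e"
    then show "\<exists>d>0. \<forall>x'\<in>UNIV. dist x' x < d \<longrightarrow>
        dist (resolvent (l n) (A s) x') (resolvent (l n) (A s) x) \<le> e"
      using resolvent_nonexpansive[OF max_mono step_pos, where y = x]
      by (intro exI[of _ e]) (fastforce simp: dist_norm intro: order_trans)
  qed
qed

lemma measurable_Y: "(\<lambda>p. Y n (fst p) (snd p)) \<in> borel_measurable (M \<Otimes>\<^sub>M borel)"
  unfolding yosida_def using measurable_resolvent[of n] by measurable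

lemma measurable_Y_compose:
  assumes "f \<in> measurable N M" "g \<in> borel_measurable N"
  shows "(\<lambda>x. Y n (f x) (g x)) \<in> borel_measurable N"
  using measurable_compose[OF measurable_Pair[OF assms] measurable_Y[of n]] by simp

lemma measurable_resolvent_compose:
  assumes "f \<in> measurable N M" "g \<in> borel_measurable N"
  shows "(\<lambda>x. resolvent (l n) (A (f x)) (g x)) \<in> borel_measurable N"
  using measurable_compose[OF measurable_Pair[OF assms] measurable_resolvent[of n]] by simp

lemma measurable_Y_1 [measurable]: "(\<lambda>s. Y n s x) \<in> borel_measurable M"
  by (rule measurable_Y_compose) auto

lemma measurable_mean_Y [measurable]: "mean_Y n \<in> borel_measurable borel"
proof -
  have "(\<lambda>(x, s). Y n s x) \<in> borel_measurable (borel \<Otimes>\<^sub>M M)"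
    unfolding case_prod_unfold by (rule measurable_Y_compose) auto
  from M.borel_measurable_lebesgue_integral[OF this] show ?thesis
    by (simp add: mean_Y_def[abs_def])
qed

lemma measurable_X_H: "X n \<in> borel_measurable (H n)"
proof (induction n)
  case 0
  show ?case by simp
next
  case (Suc n)
  show ?case
    using measurable_resolvent_compose[OF measurable_xi_H measurable_from_subalg[OF subalgebra_H_Suc Suc]]
    by simp
qed

lemma measurable_X [measurable]: "X n \<in> borel_measurable P"
  by (rule measurable_from_subalg[OF subalgebra_H measurable_X_H])

lemma measurable_xi_Suc [measurable]: "\<xi> (Suc n) \<in> measurable P M"
  by (rule xi_meas) simp

lemma measurable_Y_step [measurable]:
  "(\<lambda>\<omega>. Y n (\<xi> (Suc n) \<omega>) (X n \<omega>)) \<in> borel_measurable P"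
  by (rule measurable_Y_compose) measurable

lemma freeze:
  assumes g: "(\<lambda>p. g (fst p) (snd p)) \<in> borel_measurable (M \<Otimes>\<^sub>M borel)"
  shows "(\<integral>\<^sup>+\<omega>. g (\<xi> (Suc n) \<omega>) (X n \<omega>) \<partial>P) = (\<integral>\<^sup>+\<omega>. (\<integral>\<^sup>+s. g s (X n \<omega>) \<partial>M) \<partial>P)"
proof -
  have "(\<lambda>p. (snd p, X n (fst p))) \<in> measurable (H n \<Otimes>\<^sub>M M) (M \<Otimes>\<^sub>M borel)"
    using measurable_X_H[of n] by measurable
  from measurable_compose[OF this g]
  have "(\<lambda>p. g (snd p) (X n (fst p))) \<in> borel_measurable (H n \<Otimes>\<^sub>M M)" by simp
  from nn_integral_freeze[OF this] show ?thesis by simp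
qed

lemma zero_selection:
  assumes "z \<in> zer (mean_op M A)"
  obtains \<phi> where "\<phi> \<in> borel_measurable M" "AE s in M. \<phi> s \<in> A s z" "integrable M \<phi>"
    "integrable M (\<lambda>s. (norm (\<phi> s))\<^sup>2)" "(\<integral>s. \<phi> s \<partial>M) = 0"
proof -
  obtain \<phi> where "\<phi> \<in> selections M A 2 z" "(\<integral>s. \<phi> s \<partial>M) = 0"
    using assms zer_sub by (auto simp: zer_sel_def)
  with M.selections_props[of \<phi> A 2 z] show thesis by (intro that[of \<phi>]) auto
qed

text \<open>The linear term of the pointwise estimate integrates to zero, because the selection does.\<close>

lemma proximal_step_estimate_mean:
  assumes \<phi>: "\<phi> \<in> borel_measurable M" "AE s in M. \<phi> s \<in> A s z" "integrable M \<phi>"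
    "integrable M (\<lambda>s. (norm (\<phi> s))\<^sup>2)" "(\<integral>s. \<phi> s \<partial>M) = 0"
  shows "(\<integral>\<^sup>+s. ennreal ((norm (resolvent (l n) (A s) x - z))\<^sup>2 + (l n)\<^sup>2 / 2 * (norm (Y n s x))\<^sup>2) \<partial>M)
    \<le> ennreal ((norm (x - z))\<^sup>2 + 2 * (l n)\<^sup>2 * (\<integral>s. (norm (\<phi> s))\<^sup>2 \<partial>M))"
proof -
  let ?L = "\<lambda>s. (norm (resolvent (l n) (A s) x - z))\<^sup>2 + (l n)\<^sup>2 / 2 * (norm (Y n s x))\<^sup>2"
  let ?R = "\<lambda>s. (norm (x - z))\<^sup>2 - 2 * l n * (\<phi> s \<bullet> (x - z)) + 2 * (l n)\<^sup>2 * (norm (\<phi> s))\<^sup>2"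
  have AE: "AE s in M. ?L s \<le> ?R s"
    using \<phi>(2) by eventually_elim (rule proximal_step_estimate[OF max_mono step_pos])
  have int_inner: "integrable M (\<lambda>s. \<phi> s \<bullet> (x - z))" using \<phi>(3) by (rule integrable_inner_left)
  have int: "integrable M ?R" using int_inner \<phi>(4) by simp
  have "(\<integral>\<^sup>+s. ennreal (?L s) \<partial>M) \<le> (\<integral>\<^sup>+s. ennreal (?R s) \<partial>M)"
    by (rule nn_integral_mono_AE, rule eventually_mono[OF AE], rule ennreal_leI)
  also have "\<dots> = ennreal (\<integral>s. ?R s \<partial>M)"
  proof (rule nn_integral_eq_integral[OF int])
    show "AE s in M. 0 \<le> ?R s"
      using AE by eventually_elim (smt (verit) zero_le_power2 mult_nonneg_nonneg half_gt_zero divide_nonneg_nonneg)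
  qed
  also have "(\<integral>s. ?R s \<partial>M) = (norm (x - z))\<^sup>2 + 2 * (l n)\<^sup>2 * (\<integral>s. (norm (\<phi> s))\<^sup>2 \<partial>M)"
    using int_inner \<phi>(4) integral_inner_left[OF \<phi>(3), of "x - z"] \<phi>(5) by (simp add: M.prob_space)
  finally show ?thesis .
qed

text \<open>Summing the one-step estimates bounds the moments of the iterates and of the increments at once.\<close>

lemma moment_bound:
  assumes z: "z \<in> zer (mean_op M A)"
  shows "\<exists>K\<ge>0. \<forall>n. (\<integral>\<^sup>+\<omega>. ennreal ((norm (X n \<omega> - z))\<^sup>2) \<partial>P) \<le> ennreal K \<and>
    (\<Sum>k<n. \<integral>\<^sup>+\<omega>. ennreal ((l k)\<^sup>2 * (norm (Y k (\<xi> (Suc k) \<omega>) (X k \<omega>)))\<^sup>2) \<partial>P) \<le> ennreal K"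
proof -
  obtain \<phi> where \<phi>: "\<phi> \<in> borel_measurable M" "AE s in M. \<phi> s \<in> A s z" "integrable M \<phi>"
    "integrable M (\<lambda>s. (norm (\<phi> s))\<^sup>2)" "(\<integral>s. \<phi> s \<partial>M) = 0"
    by (rule zero_selection[OF z])
  define C where "C = (\<integral>s. (norm (\<phi> s))\<^sup>2 \<partial>M)"
  have C: "0 \<le> C" unfolding C_def by (rule Bochner_Integration.integral_nonneg) simp
  define a where "a n = (\<integral>\<^sup>+\<omega>. ennreal ((norm (X n \<omega> - z))\<^sup>2) \<partial>P)" for n
  define b where "b k = (\<integral>\<^sup>+\<omega>. ennreal ((l k)\<^sup>2 / 2 * (norm (Y k (\<xi> (Suc k) \<omega>) (X k \<omega>)))\<^sup>2) \<partial>P)" for k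
  have step: "a (Suc n) + b n \<le> a n + ennreal (2 * (l n)\<^sup>2 * C)" for n
  proof -
    let ?g = "\<lambda>s x. ennreal ((norm (resolvent (l n) (A s) x - z))\<^sup>2 + (l n)\<^sup>2 / 2 * (norm (Y n s x))\<^sup>2)"
    have g: "(\<lambda>p. ?g (fst p) (snd p)) \<in> borel_measurable (M \<Otimes>\<^sub>M borel)"
      using measurable_resolvent[of n] measurable_Y[of n] by measurable
    have "a (Suc n) + b n = (\<integral>\<^sup>+\<omega>. ennreal ((norm (X (Suc n) \<omega> - z))\<^sup>2)
        + ennreal ((l n)\<^sup>2 / 2 * (norm (Y n (\<xi> (Suc n) \<omega>) (X n \<omega>)))\<^sup>2) \<partial>P)"
      unfolding a_def b_def by (rule nn_integral_add[symmetric]) measurable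
    also have "\<dots> = (\<integral>\<^sup>+\<omega>. ?g (\<xi> (Suc n) \<omega>) (X n \<omega>) \<partial>P)"
      by (intro nn_integral_cong) (simp add: ennreal_plus)
    also have "\<dots> = (\<integral>\<^sup>+\<omega>. (\<integral>\<^sup>+s. ?g s (X n \<omega>) \<partial>M) \<partial>P)" by (rule freeze[OF g])
    also have "\<dots> \<le> (\<integral>\<^sup>+\<omega>. ennreal ((norm (X n \<omega> - z))\<^sup>2 + 2 * (l n)\<^sup>2 * C) \<partial>P)"
      unfolding C_def by (intro nn_integral_mono proximal_step_estimate_mean[OF \<phi>])
    also have "\<dots> = (\<integral>\<^sup>+\<omega>. ennreal ((norm (X n \<omega> - z))\<^sup>2) + ennreal (2 * (l n)\<^sup>2 * C) \<partial>P)"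
      using C by (intro nn_integral_cong) (simp add: ennreal_plus)
    also have "\<dots> = a n + ennreal (2 * (l n)\<^sup>2 * C)"
      unfolding a_def by (subst nn_integral_add) (auto simp: P.emeasure_space_1)
    finally show ?thesis .
  qed
  have total: "a n + (\<Sum>k<n. b k) \<le> ennreal ((norm (x0 - z))\<^sup>2 + (\<Sum>k<n. 2 * (l k)\<^sup>2 * C))" for n
  proof (induction n)
    case 0
    show ?case by (simp add: a_def P.emeasure_space_1)
  next
    case (Suc n)
    have "a (Suc n) + (\<Sum>k<Suc n. b k) = (a (Suc n) + b n) + (\<Sum>k<n. b k)"
      by (simp add: algebra_simps)
    also have "\<dots> \<le> (a n + ennreal (2 * (l n)\<^sup>2 * C)) + (\<Sum>k<n. b k)"
      by (intro add_right_mono step)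
    also have "\<dots> = (a n + (\<Sum>k<n. b k)) + ennreal (2 * (l n)\<^sup>2 * C)" by (simp add: algebra_simps)
    also have "\<dots> \<le> ennreal ((norm (x0 - z))\<^sup>2 + (\<Sum>k<n. 2 * (l k)\<^sup>2 * C)) + ennreal (2 * (l n)\<^sup>2 * C)"
      by (intro add_right_mono Suc)
    also have "\<dots> = ennreal ((norm (x0 - z))\<^sup>2 + (\<Sum>k<Suc n. 2 * (l k)\<^sup>2 * C))"
      using C by (subst ennreal_plus[symmetric]) (auto intro!: sum_nonneg add_nonneg_nonneg simp: algebra_simps)
    finally show ?case .
  qed
  define K where "K = (norm (x0 - z))\<^sup>2 + 2 * C * (\<Sum>k. (l k)\<^sup>2)"
  have S: "(\<Sum>k<n. 2 * (l k)\<^sup>2 * C) \<le> 2 * C * (\<Sum>k. (l k)\<^sup>2)" for n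
  proof -
    have "(\<Sum>k<n. 2 * (l k)\<^sup>2 * C) = 2 * C * (\<Sum>k<n. (l k)\<^sup>2)"
      by (simp add: sum_distrib_left mult_ac)
    also have "\<dots> \<le> 2 * C * (\<Sum>k. (l k)\<^sup>2)"
      using C step_sq by (intro mult_left_mono sum_le_suminf) auto
    finally show ?thesis .
  qed
  have K: "0 \<le> K" unfolding K_def using C step_sq by (intro add_nonneg_nonneg mult_nonneg_nonneg suminf_nonneg) auto
  \<comment> \<open>The factor \<open>1 / 2\<close> in \<open>b\<close> is the reason why the common bound is \<open>2 * K\<close>.\<close>
  have total_K: "a n + (\<Sum>k<n. b k) \<le> ennreal K" for n
    using total[of n] S[of n] by (rule_tac order_trans) (auto simp: K_def intro: ennreal_leI)
  have "a n \<le> ennreal (2 * K)" for n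
  proof -
    have "a n \<le> ennreal K"
      using total_K[of n] by (rule order_trans[rotated]) simp
    also have "\<dots> \<le> ennreal (2 * K)" using K by (intro ennreal_leI) simp
    finally show ?thesis .
  qed
  moreover have "(\<Sum>k<n. \<integral>\<^sup>+\<omega>. ennreal ((l k)\<^sup>2 * (norm (Y k (\<xi> (Suc k) \<omega>) (X k \<omega>)))\<^sup>2) \<partial>P) \<le> ennreal (2 * K)" for n
  proof -
    have "(\<integral>\<^sup>+\<omega>. ennreal ((l k)\<^sup>2 * (norm (Y k (\<xi> (Suc k) \<omega>) (X k \<omega>)))\<^sup>2) \<partial>P) = 2 * b k" for k
    proof -
      have "2 * b k = (\<integral>\<^sup>+\<omega>. 2 * ennreal ((l k)\<^sup>2 / 2 * (norm (Y k (\<xi> (Suc k) \<omega>) (X k \<omega>)))\<^sup>2) \<partial>P)"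
        unfolding b_def by (rule nn_integral_cmult[symmetric]) measurable
      also have "\<dots> = (\<integral>\<^sup>+\<omega>. ennreal ((l k)\<^sup>2 * (norm (Y k (\<xi> (Suc k) \<omega>) (X k \<omega>)))\<^sup>2) \<partial>P)"
        by (intro nn_integral_cong) (simp add: ennreal_numeral[symmetric] ennreal_mult[symmetric] del: ennreal_numeral)
      finally show ?thesis by simp
    qed
    then have "(\<Sum>k<n. \<integral>\<^sup>+\<omega>. ennreal ((l k)\<^sup>2 * (norm (Y k (\<xi> (Suc k) \<omega>) (X k \<omega>)))\<^sup>2) \<partial>P) = 2 * (\<Sum>k<n. b k)"
      by (simp add: sum_distrib_left)
    also have "\<dots> \<le> 2 * ennreal K"
      using total_K[of n] by (intro mult_left_mono) (auto intro: order_trans[rotated])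
    also have "\<dots> = ennreal (2 * K)" using K by (simp add: ennreal_mult)
    finally show ?thesis .
  qed
  ultimately show ?thesis using K by (intro exI[of _ "2 * K"]) (simp add: a_def)
qed

lemma increments_summable_bound:
  "\<exists>c. summable c \<and> (\<forall>k. 0 \<le> c k) \<and>
    (\<forall>k. (\<integral>\<^sup>+\<omega>. ennreal ((l k)\<^sup>2 * (norm (Y k (\<xi> (Suc k) \<omega>) (X k \<omega>)))\<^sup>2) \<partial>P) = ennreal (c k))"
proof -
  let ?b = "\<lambda>k. \<integral>\<^sup>+\<omega>. ennreal ((l k)\<^sup>2 * (norm (Y k (\<xi> (Suc k) \<omega>) (X k \<omega>)))\<^sup>2) \<partial>P"
  obtain z where "z \<in> zer (mean_op M A)" using zer_nonempty by auto
  then obtain K where K: "0 \<le> K" "\<And>n. (\<Sum>k<n. ?b k) \<le> ennreal K" using moment_bound by meson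
  have fin: "?b k < \<infinity>" for k
  proof -
    have "?b k \<le> (\<Sum>k<Suc k. ?b k)" by simp
    also have "\<dots> \<le> ennreal K" by (rule K)
    also have "\<dots> < \<infinity>" by simp
    finally show ?thesis .
  qed
  define c where "c k = enn2real (?b k)" for k
  have b: "?b k = ennreal (c k)" for k
    unfolding c_def using fin[of k] by simp
  have c: "0 \<le> c k" for k by (simp add: c_def)
  have "(\<Sum>k<n. c k) \<le> K" for n
    using K(2)[of n] K(1) c unfolding b by (simp add: sum_ennreal)
  then have "summable c" by (intro summableI_nonneg_bounded[where x = K] c)
  with c b show ?thesis by blast
qed

lemma AE_increments_summable:
  "AE \<omega> in P. summable (\<lambda>k. (l k)\<^sup>2 * (norm (Y k (\<xi> (Suc k) \<omega>) (X k \<omega>)))\<^sup>2)"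
proof -
  obtain c where c: "summable c" "\<And>k. 0 \<le> c k"
    "\<And>k. (\<integral>\<^sup>+\<omega>. ennreal ((l k)\<^sup>2 * (norm (Y k (\<xi> (Suc k) \<omega>) (X k \<omega>)))\<^sup>2) \<partial>P) = ennreal (c k)"
    using increments_summable_bound by blast
  show ?thesis
    by (rule AE_summable_if_nn_integral_le[where c = c]) (use c in auto)
qed

text \<open>
  A centred function of the fresh draw and of the current iterate gives martingale differences,
  whose series converges as soon as their variances are summable.
\<close>

lemma AE_centred_series_summable:
  fixes \<psi> :: "nat \<Rightarrow> 'e \<Rightarrow> 'h \<Rightarrow> real"
  assumes meas: "\<And>n. (\<lambda>p. \<psi> n (fst p) (snd p)) \<in> borel_measurable (M \<Otimes>\<^sub>M borel)"
    and centred: "\<And>n x. (\<integral>s. \<psi> n s x \<partial>M) = 0"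
    and le: "\<And>n. (\<integral>\<^sup>+\<omega>. (\<integral>\<^sup>+s. ennreal ((\<psi> n s (X n \<omega>))\<^sup>2) \<partial>M) \<partial>P) \<le> ennreal (c n)"
    and c: "summable c" "\<And>n. 0 \<le> c n"
  shows "AE \<omega> in P. summable (\<lambda>n. \<psi> n (\<xi> (Suc n) \<omega>) (X n \<omega>))"
proof -
  let ?d = "\<lambda>n \<omega>. \<psi> n (\<xi> (Suc n) \<omega>) (X n \<omega>)"
  have compose: "(\<lambda>x. \<psi> n (f x) (g x)) \<in> borel_measurable N"
    if "f \<in> measurable N M" "g \<in> borel_measurable N" for n f g and N :: "'z measure"
    using measurable_compose[OF measurable_Pair[OF that] meas[of n]] by simp
  have adapted: "?d n \<in> borel_measurable (H (Suc n))" for n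
    using measurable_compose[OF measurable_Pair[OF measurable_xi_H measurable_from_subalg[OF subalgebra_H_Suc measurable_X_H]] meas]
    by simp
  have d_meas: "?d n \<in> borel_measurable P" for n
    by (rule measurable_from_subalg[OF subalgebra_H adapted])
  have sq_le: "(\<integral>\<^sup>+\<omega>. ennreal ((?d n \<omega>)\<^sup>2) \<partial>P) \<le> ennreal (c n)" for n
  proof -
    have "(\<lambda>p. ennreal ((\<psi> n (fst p) (snd p))\<^sup>2)) \<in> borel_measurable (M \<Otimes>\<^sub>M borel)"
      using meas[of n] by measurable
    from freeze[OF this] show ?thesis using le[of n] by simp
  qed
  have sq_int: "integrable P (\<lambda>\<omega>. (?d n \<omega>)\<^sup>2)" for n
  proof (rule integrableI_bounded)
    show "(\<lambda>\<omega>. (?d n \<omega>)\<^sup>2) \<in> borel_measurable P" using d_meas[of n] by measurable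
    show "(\<integral>\<^sup>+\<omega>. ennreal (norm ((?d n \<omega>)\<^sup>2)) \<partial>P) < \<infinity>"
      using sq_le[of n] by (simp add: order_le_less_trans)
  qed
  interpret L2_martingale_differences P H ?d
  proof
    show "(\<integral>\<omega>. g \<omega> * ?d n \<omega> \<partial>P) = 0"
      if g: "g \<in> borel_measurable (H n)" and int: "integrable P (\<lambda>\<omega>. g \<omega> * ?d n \<omega>)" for n g
    proof -
      have "(\<lambda>p. (snd p, X n (fst p))) \<in> measurable (H n \<Otimes>\<^sub>M M) (M \<Otimes>\<^sub>M borel)"
        using measurable_X_H[of n] by measurable
      from measurable_compose[OF this meas[of n]]
      have "(\<lambda>p. g (fst p) * \<psi> n (snd p) (X n (fst p))) \<in> borel_measurable (H n \<Otimes>\<^sub>M M)"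
        using g by simp
      from expectation_freeze_zero[OF this] int centred[of n] show ?thesis by simp
    qed
  qed (use subalgebra_H subalgebra_H_Suc adapted sq_int in auto)
  have "(\<integral>\<omega>. (?d n \<omega>)\<^sup>2 \<partial>P) \<le> c n" for n
    using sq_le[of n] c(2)[of n] nn_integral_eq_integral[OF sq_int[of n]] by simp
  then have "summable (\<lambda>n. \<integral>\<omega>. (?d n \<omega>)\<^sup>2 \<partial>P)"
    by (intro summable_comparison_test'[OF c(1), of 0]) simp
  then show ?thesis by (rule AE_summable)
qed


section \<open>Almost sure behaviour of the iterates\<close>

text \<open>
  The linear terms of the one-step estimates at \<open>z\<close> form a convergent martingale and the quadratic
  ones are summable, so the squared distances are decreasing up to a convergent series.
\<close>

lemma AE_dist_to_zero_convergent:
  assumes z: "z \<in> zer (mean_op M A)"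
  shows "AE \<omega> in P. convergent (\<lambda>n. norm (X n \<omega> - z))"
proof -
  obtain \<phi> where \<phi> [measurable]: "\<phi> \<in> borel_measurable M" and mem: "AE s in M. \<phi> s \<in> A s z"
    and int: "integrable M \<phi>" and sq: "integrable M (\<lambda>s. (norm (\<phi> s))\<^sup>2)"
    and zero: "(\<integral>s. \<phi> s \<partial>M) = 0"
    by (rule zero_selection[OF z])
  obtain K where K: "0 \<le> K" "\<And>n. (\<integral>\<^sup>+\<omega>. ennreal ((norm (X n \<omega> - z))\<^sup>2) \<partial>P) \<le> ennreal K"
    using moment_bound[OF z] by meson
  define C where "C = (\<integral>s. (norm (\<phi> s))\<^sup>2 \<partial>M)"
  have C: "0 \<le> C" unfolding C_def by (rule Bochner_Integration.integral_nonneg) simp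
  have nn_C: "(\<integral>\<^sup>+s. ennreal ((norm (\<phi> s))\<^sup>2) \<partial>M) = ennreal C"
    unfolding C_def by (rule nn_integral_eq_integral[OF sq]) simp
  have series: "AE \<omega> in P. summable (\<lambda>n. l n * (\<phi> (\<xi> (Suc n) \<omega>) \<bullet> (X n \<omega> - z)))"
  proof (rule AE_centred_series_summable[where \<psi> = "\<lambda>n s x. l n * (\<phi> s \<bullet> (x - z))"
        and c = "\<lambda>n. (l n)\<^sup>2 * (C * K)"])
    show "(\<lambda>p. l n * (\<phi> (fst p) \<bullet> (snd p - z))) \<in> borel_measurable (M \<Otimes>\<^sub>M borel)" for n by measurable
    show "(\<integral>s. l n * (\<phi> s \<bullet> (x - z)) \<partial>M) = 0" for n x
      using integral_inner_left[OF int, of "x - z"] zero by simp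
    show "(\<integral>\<^sup>+\<omega>. (\<integral>\<^sup>+s. ennreal ((l n * (\<phi> s \<bullet> (X n \<omega> - z)))\<^sup>2) \<partial>M) \<partial>P) \<le> ennreal ((l n)\<^sup>2 * (C * K))" for n
    proof -
      have "(\<integral>\<^sup>+s. ennreal ((l n * (\<phi> s \<bullet> (x - z)))\<^sup>2) \<partial>M) \<le> ennreal ((l n)\<^sup>2 * C) * ennreal ((norm (x - z))\<^sup>2)" for x
      proof -
        have "(\<integral>\<^sup>+s. ennreal ((l n * (\<phi> s \<bullet> (x - z)))\<^sup>2) \<partial>M)
          \<le> (\<integral>\<^sup>+s. ennreal ((l n)\<^sup>2 * (norm (x - z))\<^sup>2) * ennreal ((norm (\<phi> s))\<^sup>2) \<partial>M)"
        proof (rule nn_integral_mono)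
          fix s
          have "(\<phi> s \<bullet> (x - z))\<^sup>2 \<le> (norm (\<phi> s))\<^sup>2 * (norm (x - z))\<^sup>2"
            using Cauchy_Schwarz_ineq[of "\<phi> s" "x - z"] by (simp add: power2_norm_eq_inner)
          then have "(l n * (\<phi> s \<bullet> (x - z)))\<^sup>2 \<le> (l n)\<^sup>2 * (norm (x - z))\<^sup>2 * (norm (\<phi> s))\<^sup>2"
            unfolding power_mult_distrib mult.assoc by (intro mult_left_mono) (auto simp: mult.commute)
          then show "ennreal ((l n * (\<phi> s \<bullet> (x - z)))\<^sup>2)
            \<le> ennreal ((l n)\<^sup>2 * (norm (x - z))\<^sup>2) * ennreal ((norm (\<phi> s))\<^sup>2)"
            by (simp add: ennreal_mult[symmetric] ennreal_leI)
        qed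
        also have "\<dots> = ennreal ((l n)\<^sup>2 * (norm (x - z))\<^sup>2) * ennreal C"
          by (subst nn_integral_cmult) (auto simp: nn_C)
        also have "\<dots> = ennreal ((l n)\<^sup>2 * C) * ennreal ((norm (x - z))\<^sup>2)"
          using C by (simp add: ennreal_mult[symmetric] mult_ac)
        finally show ?thesis .
      qed
      then have "(\<integral>\<^sup>+\<omega>. (\<integral>\<^sup>+s. ennreal ((l n * (\<phi> s \<bullet> (X n \<omega> - z)))\<^sup>2) \<partial>M) \<partial>P)
        \<le> (\<integral>\<^sup>+\<omega>. ennreal ((l n)\<^sup>2 * C) * ennreal ((norm (X n \<omega> - z))\<^sup>2) \<partial>P)"
        by (rule nn_integral_mono)
      also have "\<dots> = ennreal ((l n)\<^sup>2 * C) * (\<integral>\<^sup>+\<omega>. ennreal ((norm (X n \<omega> - z))\<^sup>2) \<partial>P)"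
        by (rule nn_integral_cmult) measurable
      also have "\<dots> \<le> ennreal ((l n)\<^sup>2 * C) * ennreal K" by (intro mult_left_mono K) simp
      also have "\<dots> = ennreal ((l n)\<^sup>2 * (C * K))"
        using C K by (simp add: ennreal_mult[symmetric] mult_ac)
      finally show ?thesis .
    qed
    show "summable (\<lambda>n. (l n)\<^sup>2 * (C * K))" by (rule summable_mult2[OF step_sq])
  qed (use C K in auto)
  have squares: "AE \<omega> in P. summable (\<lambda>n. (l n)\<^sup>2 * (norm (\<phi> (\<xi> (Suc n) \<omega>)))\<^sup>2)"
  proof (rule AE_summable_if_nn_integral_le[where c = "\<lambda>n. (l n)\<^sup>2 * C"])
    show "(\<integral>\<^sup>+\<omega>. ennreal ((l n)\<^sup>2 * (norm (\<phi> (\<xi> (Suc n) \<omega>)))\<^sup>2) \<partial>P) \<le> ennreal ((l n)\<^sup>2 * C)" for n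
    proof -
      have "(\<integral>\<^sup>+\<omega>. ennreal ((l n)\<^sup>2 * (norm (\<phi> (\<xi> (Suc n) \<omega>)))\<^sup>2) \<partial>P)
        = (\<integral>\<^sup>+\<omega>. (\<integral>\<^sup>+s. ennreal ((l n)\<^sup>2 * (norm (\<phi> s))\<^sup>2) \<partial>M) \<partial>P)"
        by (rule freeze[where g = "\<lambda>s x. ennreal ((l n)\<^sup>2 * (norm (\<phi> s))\<^sup>2)"]) measurable
      also have "\<dots> = (\<integral>\<^sup>+s. ennreal ((l n)\<^sup>2) * ennreal ((norm (\<phi> s))\<^sup>2) \<partial>M)"
        by (simp add: P.emeasure_space_1 ennreal_mult)
      also have "\<dots> = ennreal ((l n)\<^sup>2) * ennreal C" by (subst nn_integral_cmult) (auto simp: nn_C)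
      finally show ?thesis using C by (simp add: ennreal_mult)
    qed
    show "summable (\<lambda>n. (l n)\<^sup>2 * C)" by (rule summable_mult2[OF step_sq])
  qed (use C in auto)
  from series squares AE_xi[OF mem] show ?thesis
  proof eventually_elim
    fix \<omega>
    assume s1: "summable (\<lambda>n. l n * (\<phi> (\<xi> (Suc n) \<omega>) \<bullet> (X n \<omega> - z)))"
      and s2: "summable (\<lambda>n. (l n)\<^sup>2 * (norm (\<phi> (\<xi> (Suc n) \<omega>)))\<^sup>2)"
      and mem: "\<forall>n. \<phi> (\<xi> (Suc n) \<omega>) \<in> A (\<xi> (Suc n) \<omega>) z"
    have "convergent (\<lambda>n. (norm (X n \<omega> - z))\<^sup>2)"
    proof (rule almost_decreasing_convergent)
      show "summable (\<lambda>n. (- 2) * (l n * (\<phi> (\<xi> (Suc n) \<omega>) \<bullet> (X n \<omega> - z)))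
          + 2 * ((l n)\<^sup>2 * (norm (\<phi> (\<xi> (Suc n) \<omega>)))\<^sup>2))"
        by (intro summable_add summable_mult s1 s2)
      fix n
      have "0 \<le> (l n)\<^sup>2 / 2 * (norm (Y n (\<xi> (Suc n) \<omega>) (X n \<omega>)))\<^sup>2" by simp
      then show "(norm (X (Suc n) \<omega> - z))\<^sup>2 \<le> (norm (X n \<omega> - z))\<^sup>2 +
        ((- 2) * (l n * (\<phi> (\<xi> (Suc n) \<omega>) \<bullet> (X n \<omega> - z))) + 2 * ((l n)\<^sup>2 * (norm (\<phi> (\<xi> (Suc n) \<omega>)))\<^sup>2))"
        using proximal_step_estimate[OF max_mono step_pos[of n] mem[rule_format, of n], of "X n \<omega>"]
        unfolding prox_seq.simps mult.assoc by linarith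
    qed simp
    then obtain L where "(\<lambda>n. (norm (X n \<omega> - z))\<^sup>2) \<longlonglongrightarrow> L" by (auto simp: convergent_def)
    from tendsto_real_sqrt[OF this] show "convergent (\<lambda>n. norm (X n \<omega> - z))"
      by (auto simp: convergent_def)
  qed
qed

text \<open>
  At a zero, the square-integrable selection dominates the Yosida approximation; Lipschitz
  continuity in the point carries this over to every other point.
\<close>

lemma integrable_Y: "integrable M (\<lambda>s. Y n s x)" "integrable M (\<lambda>s. (norm (Y n s x))\<^sup>2)"
proof -
  obtain z where z: "z \<in> zer (mean_op M A)" using zer_nonempty by auto
  obtain \<phi> where [measurable]: "\<phi> \<in> borel_measurable M" and mem: "AE s in M. \<phi> s \<in> A s z"
    and int: "integrable M \<phi>" and sq: "integrable M (\<lambda>s. (norm (\<phi> s))\<^sup>2)"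
    by (rule zero_selection[OF z])
  define C where "C = 2 * norm (x - z) / l n"
  have C: "0 \<le> C" using step_pos[of n] by (simp add: C_def)
  have le: "AE s in M. norm (Y n s x) \<le> norm (\<phi> s) + C"
    using mem
  proof eventually_elim
    fix s assume "\<phi> s \<in> A s z"
    then show "norm (Y n s x) \<le> norm (\<phi> s) + C"
      using yosida_norm_le[OF max_mono[of s] step_pos[of n], of "\<phi> s" z]
        yosida_lipschitz[OF max_mono[of s] step_pos[of n], of x z] norm_triangle_sub[of "Y n s x" "Y n s z"]
      unfolding C_def by linarith
  qed
  show "integrable M (\<lambda>s. Y n s x)"
  proof (rule Bochner_Integration.integrable_bound)
    show "integrable M (\<lambda>s. norm (\<phi> s) + C)" using int by simp
    show "AE s in M. norm (Y n s x) \<le> norm (norm (\<phi> s) + C)"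
      using le C by (auto elim: eventually_mono)
  qed measurable
  show "integrable M (\<lambda>s. (norm (Y n s x))\<^sup>2)"
  proof (rule Bochner_Integration.integrable_bound)
    show "integrable M (\<lambda>s. 2 * (norm (\<phi> s))\<^sup>2 + 2 * C\<^sup>2)" using sq by simp
    show "AE s in M. norm ((norm (Y n s x))\<^sup>2) \<le> norm (2 * (norm (\<phi> s))\<^sup>2 + 2 * C\<^sup>2)"
      using le
    proof eventually_elim
      fix s assume "norm (Y n s x) \<le> norm (\<phi> s) + C"
      then have "(norm (Y n s x))\<^sup>2 \<le> (norm (\<phi> s) + C)\<^sup>2" by (intro power_mono) auto
      also have "\<dots> \<le> 2 * (norm (\<phi> s))\<^sup>2 + 2 * C\<^sup>2"
        using zero_le_power2[of "norm (\<phi> s) - C"] unfolding power2_sum power2_diff by linarith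
      finally show "norm ((norm (Y n s x))\<^sup>2) \<le> norm (2 * (norm (\<phi> s))\<^sup>2 + 2 * C\<^sup>2)" by simp
    qed
  qed measurable
qed

lemma centred_second_moment_le:
  "(\<integral>\<^sup>+s. ennreal ((norm (Y n s x - mean_Y n x))\<^sup>2) \<partial>M) \<le> (\<integral>\<^sup>+s. ennreal ((norm (Y n s x))\<^sup>2) \<partial>M)"
proof -
  let ?m = "mean_Y n x"
  have eq: "(norm (Y n s x - ?m))\<^sup>2 = (norm (Y n s x))\<^sup>2 - 2 * (Y n s x \<bullet> ?m) + (norm ?m)\<^sup>2" for s
    by (simp add: power2_norm_eq_inner inner_simps inner_commute)
  have int: "integrable M (\<lambda>s. Y n s x \<bullet> ?m)" using integrable_Y(1) by (rule integrable_inner_left)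
  have int2: "integrable M (\<lambda>s. (norm (Y n s x - ?m))\<^sup>2)" unfolding eq using int integrable_Y(2) by simp
  have "(\<integral>s. (norm (Y n s x - ?m))\<^sup>2 \<partial>M) = (\<integral>s. (norm (Y n s x))\<^sup>2 \<partial>M) - (norm ?m)\<^sup>2"
    unfolding eq using int integrable_Y(2)[of n x] integral_inner_left[OF integrable_Y(1)[of n x], of ?m]
    by (simp add: M.prob_space mean_Y_def power2_norm_eq_inner)
  then have "(\<integral>s. (norm (Y n s x - ?m))\<^sup>2 \<partial>M) \<le> (\<integral>s. (norm (Y n s x))\<^sup>2 \<partial>M)" by simp
  then show ?thesis
    by (simp add: nn_integral_eq_integral[OF int2] nn_integral_eq_integral[OF integrable_Y(2)] ennreal_leI)
qed

text \<open>
  Truncating the test direction makes it bounded, so that only the second moments of the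
  increments enter; a bounded path is not affected by the truncation once \<open>R\<close> is large.
\<close>

lemma AE_centred_increments_summable:
  fixes x :: 'h and R :: real
  defines "g \<equiv> \<lambda>u. if norm (u - x) \<le> R then u - x else 0"
  shows "AE \<omega> in P. summable (\<lambda>n. l n * ((Y n (\<xi> (Suc n) \<omega>) (X n \<omega>) - mean_Y n (X n \<omega>)) \<bullet> g (X n \<omega>)))"
proof -
  obtain c where c: "summable c" "\<And>k. 0 \<le> c k"
    "\<And>k. (\<integral>\<^sup>+\<omega>. ennreal ((l k)\<^sup>2 * (norm (Y k (\<xi> (Suc k) \<omega>) (X k \<omega>)))\<^sup>2) \<partial>P) = ennreal (c k)"
    using increments_summable_bound by blast
  have [measurable]: "g \<in> borel_measurable borel" unfolding g_def by measurable
  have g: "(norm (g u))\<^sup>2 \<le> R\<^sup>2" for u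
    unfolding g_def by (auto intro: power_mono)
  show ?thesis
  proof (rule AE_centred_series_summable[where \<psi> = "\<lambda>n s u. l n * ((Y n s u - mean_Y n u) \<bullet> g u)"
        and c = "\<lambda>n. R\<^sup>2 * c n"])
    show "(\<lambda>p. l n * ((Y n (fst p) (snd p) - mean_Y n (snd p)) \<bullet> g (snd p))) \<in> borel_measurable (M \<Otimes>\<^sub>M borel)" for n
      using measurable_Y[of n] by measurable
    show "(\<integral>s. l n * ((Y n s u - mean_Y n u) \<bullet> g u) \<partial>M) = 0" for n u
    proof -
      have int: "integrable M (\<lambda>s. Y n s u - mean_Y n u)" using integrable_Y(1)[of n u] by simp
      have "(\<integral>s. Y n s u - mean_Y n u \<partial>M) = 0"
        using integrable_Y(1)[of n u] by (simp add: mean_Y_def M.prob_space)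
      then show ?thesis using integral_inner_left[OF int, of "g u"] by simp
    qed
    show "(\<integral>\<^sup>+\<omega>. (\<integral>\<^sup>+s. ennreal ((l n * ((Y n s (X n \<omega>) - mean_Y n (X n \<omega>)) \<bullet> g (X n \<omega>)))\<^sup>2) \<partial>M) \<partial>P)
      \<le> ennreal (R\<^sup>2 * c n)" for n
    proof -
      have "(\<integral>\<^sup>+s. ennreal ((l n * ((Y n s u - mean_Y n u) \<bullet> g u))\<^sup>2) \<partial>M)
        \<le> (\<integral>\<^sup>+s. ennreal (R\<^sup>2) * ennreal ((l n)\<^sup>2 * (norm (Y n s u))\<^sup>2) \<partial>M)" for u
      proof -
        have "(\<integral>\<^sup>+s. ennreal ((l n * ((Y n s u - mean_Y n u) \<bullet> g u))\<^sup>2) \<partial>M)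
          \<le> (\<integral>\<^sup>+s. ennreal ((l n)\<^sup>2 * R\<^sup>2) * ennreal ((norm (Y n s u - mean_Y n u))\<^sup>2) \<partial>M)"
        proof (rule nn_integral_mono)
          fix s
          let ?d = "Y n s u - mean_Y n u"
          have "(?d \<bullet> g u)\<^sup>2 \<le> (norm ?d)\<^sup>2 * (norm (g u))\<^sup>2"
            using Cauchy_Schwarz_ineq[of ?d "g u"] by (simp add: power2_norm_eq_inner)
          also have "\<dots> \<le> (norm ?d)\<^sup>2 * R\<^sup>2" by (intro mult_left_mono g) simp
          finally have "(l n)\<^sup>2 * (?d \<bullet> g u)\<^sup>2 \<le> (l n)\<^sup>2 * ((norm ?d)\<^sup>2 * R\<^sup>2)"
            by (intro mult_left_mono) auto
          then have "(l n * (?d \<bullet> g u))\<^sup>2 \<le> (l n)\<^sup>2 * R\<^sup>2 * (norm ?d)\<^sup>2"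
            by (simp add: power_mult_distrib mult_ac)
          then show "ennreal ((l n * (?d \<bullet> g u))\<^sup>2) \<le> ennreal ((l n)\<^sup>2 * R\<^sup>2) * ennreal ((norm ?d)\<^sup>2)"
            by (simp add: ennreal_mult[symmetric] ennreal_leI)
        qed
        also have "\<dots> = ennreal ((l n)\<^sup>2 * R\<^sup>2) * (\<integral>\<^sup>+s. ennreal ((norm (Y n s u - mean_Y n u))\<^sup>2) \<partial>M)"
          by (rule nn_integral_cmult) measurable
        also have "\<dots> \<le> ennreal ((l n)\<^sup>2 * R\<^sup>2) * (\<integral>\<^sup>+s. ennreal ((norm (Y n s u))\<^sup>2) \<partial>M)"
          by (intro mult_left_mono centred_second_moment_le) simp
        also have "\<dots> = (\<integral>\<^sup>+s. ennreal ((l n)\<^sup>2 * R\<^sup>2) * ennreal ((norm (Y n s u))\<^sup>2) \<partial>M)"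
          by (rule nn_integral_cmult[symmetric]) measurable
        also have "\<dots> = (\<integral>\<^sup>+s. ennreal (R\<^sup>2) * ennreal ((l n)\<^sup>2 * (norm (Y n s u))\<^sup>2) \<partial>M)"
          by (intro nn_integral_cong) (simp add: ennreal_mult[symmetric] mult_ac)
        finally show ?thesis .
      qed
      then have "(\<integral>\<^sup>+\<omega>. (\<integral>\<^sup>+s. ennreal ((l n * ((Y n s (X n \<omega>) - mean_Y n (X n \<omega>)) \<bullet> g (X n \<omega>)))\<^sup>2) \<partial>M) \<partial>P)
        \<le> (\<integral>\<^sup>+\<omega>. (\<integral>\<^sup>+s. ennreal (R\<^sup>2) * ennreal ((l n)\<^sup>2 * (norm (Y n s (X n \<omega>)))\<^sup>2) \<partial>M) \<partial>P)"
        by (rule nn_integral_mono)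
      also have "\<dots> = (\<integral>\<^sup>+\<omega>. ennreal (R\<^sup>2) * ennreal ((l n)\<^sup>2 * (norm (Y n (\<xi> (Suc n) \<omega>) (X n \<omega>)))\<^sup>2) \<partial>P)"
        by (rule freeze[symmetric, where g = "\<lambda>s u. ennreal (R\<^sup>2) * ennreal ((l n)\<^sup>2 * (norm (Y n s u))\<^sup>2)"])
          (use measurable_Y[of n] in measurable)
      also have "\<dots> = ennreal (R\<^sup>2) * ennreal (c n)"
        unfolding c(3)[symmetric] by (rule nn_integral_cmult) measurable
      finally show ?thesis using c(2) by (simp add: ennreal_mult)
    qed
    show "summable (\<lambda>n. R\<^sup>2 * c n)" using c(1) by (rule summable_mult)
  qed (use c in auto)
qed

text \<open>
  Expanding \<open>(norm (X (Suc k) \<omega> - x))\<^sup>2\<close> turns the pairing of the increment with \<open>X k \<omega> - x\<close> into a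
  telescoping sum and the summable squares of the increments; the centred increments account for
  the difference between an increment and its mean.
\<close>

lemma AE_drift_bounded_above:
  "AE \<omega> in P. \<exists>C. \<forall>n. (\<Sum>k=1..n. l k * (mean_Y k (X k \<omega>) \<bullet> (X k \<omega> - x))) \<le> C"
proof -
  obtain z where z: "z \<in> zer (mean_op M A)" using zer_nonempty by auto
  have "AE \<omega> in P. \<forall>R::nat. summable (\<lambda>n. l n * ((Y n (\<xi> (Suc n) \<omega>) (X n \<omega>) - mean_Y n (X n \<omega>)) \<bullet>
      (if norm (X n \<omega> - x) \<le> real R then X n \<omega> - x else 0)))"
    unfolding AE_all_countable by (intro allI AE_centred_increments_summable)
  with AE_increments_summable AE_dist_to_zero_convergent[OF z] show ?thesis
  proof eventually_elim
    fix \<omega>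
    let ?y = "\<lambda>n. Y n (\<xi> (Suc n) \<omega>) (X n \<omega>)"
    let ?m = "\<lambda>n. l n * ((?y n - mean_Y n (X n \<omega>)) \<bullet> (X n \<omega> - x))"
    let ?p = "\<lambda>n. l n * (mean_Y n (X n \<omega>) \<bullet> (X n \<omega> - x))"
    let ?w = "\<lambda>n. (norm (X n \<omega> - x))\<^sup>2"
    assume inc: "summable (\<lambda>n. (l n)\<^sup>2 * (norm (?y n))\<^sup>2)"
      and conv: "convergent (\<lambda>n. norm (X n \<omega> - z))"
      and centred: "\<forall>R::nat. summable (\<lambda>n. l n * ((?y n - mean_Y n (X n \<omega>)) \<bullet>
        (if norm (X n \<omega> - x) \<le> real R then X n \<omega> - x else 0)))"
    obtain B where B: "\<And>n. \<bar>norm (X n \<omega> - z)\<bar> \<le> B"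
      using convergent_imp_Bseq[OF conv] by (auto simp: Bseq_def)
    obtain R where R: "B + norm (z - x) \<le> real R" using real_arch_simple by blast
    have "norm (X n \<omega> - x) \<le> real R" for n
      using B[of n] R norm_triangle_ineq[of "X n \<omega> - z" "z - x"] by simp
    then have m: "summable ?m" using centred[rule_format, of R] by simp
    obtain K1 where K1: "\<And>n. \<bar>\<Sum>k<n. ?m k\<bar> \<le> K1"
      using convergent_imp_Bseq[OF summable_iff_convergent[THEN iffD1, OF m]] by (auto simp: Bseq_def)
    have p: "?p k = (?w k - ?w (Suc k)) / 2 + (l k)\<^sup>2 * (norm (?y k))\<^sup>2 / 2 - ?m k" for k
    proof -
      have "X (Suc k) \<omega> - x = (X k \<omega> - x) + (- l k) *\<^sub>R ?y k"
        using X_Suc_decomp[of k \<omega>] by (simp add: algebra_simps)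
      then have "?w (Suc k) = ?w k - 2 * l k * ((X k \<omega> - x) \<bullet> ?y k) + (l k)\<^sup>2 * (norm (?y k))\<^sup>2"
        by (simp only: norm_add_scaleR_sq) simp
      moreover have "?m k + ?p k = l k * ((X k \<omega> - x) \<bullet> ?y k)"
        by (simp add: inner_diff_left inner_diff_right inner_commute algebra_simps)
      ultimately show ?thesis by argo
    qed
    define U where "U n = (\<Sum>k<n. (l k)\<^sup>2 * (norm (?y k))\<^sup>2)" for n
    define V where "V n = (\<Sum>k<n. ?m k)" for n
    have sum_p: "(\<Sum>k<n. ?p k) = (?w 0 - ?w n) / 2 + U n / 2 - V n" for n
      by (induction n) (simp add: U_def V_def, simp only: sum.lessThan_Suc p U_def V_def, simp add: field_simps)
    define C where "C = ?w 0 / 2 + (\<Sum>k. (l k)\<^sup>2 * (norm (?y k))\<^sup>2) / 2 + K1 - ?p 0"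
    have "(\<Sum>k=1..n. ?p k) \<le> C" for n
    proof -
      have "(\<Sum>k=1..n. ?p k) = (\<Sum>k<Suc n. ?p k) - ?p 0"
        by (induction n) simp_all
      moreover have "U (Suc n) \<le> (\<Sum>k. (l k)\<^sup>2 * (norm (?y k))\<^sup>2)"
        unfolding U_def using inc by (intro sum_le_suminf) auto
      moreover have "0 \<le> ?w (Suc n)" by simp
      moreover have "s \<le> a / 2 + S / 2 + K - q"
        if "s = (a - b) / 2 + t / 2 - v - q" "t \<le> S" "0 \<le> b" "\<bar>v\<bar> \<le> K" for s a b t S v q K :: real
        using that abs_ge_minus_self[of v] by argo
      ultimately show ?thesis
        unfolding sum_p C_def using K1[of "Suc n", folded V_def] by blast
    qed
    then show "\<exists>C. \<forall>n. (\<Sum>k=1..n. ?p k) \<le> C" by blast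
  qed
qed


section \<open>Weak cluster points of the averages are zeros\<close>

lemma step_tendsto_0: "l \<longlonglongrightarrow> 0"
proof -
  have "(\<lambda>n. sqrt ((l n)\<^sup>2)) \<longlonglongrightarrow> sqrt 0"
    by (intro tendsto_real_sqrt summable_LIMSEQ_zero[OF step_sq])
  then show ?thesis using step_pos by (simp add: less_imp_le)
qed

text \<open>
  This is where uniform integrability of the least-norm selections enters. Integrating the
  truncated pairing bound, the error splits into a term of order \<open>l k * c\<^sup>2\<close>, which vanishes with the
  step sizes, and into tails that are small uniformly in the iterate once the truncation levels
  \<open>b \<le> c\<close> are large. No moment of the selection beyond the first is available at a general \<open>x\<close>.
\<close>

lemma mean_Y_pairing_eventually_ge:
  assumes \<phi>: "\<phi> \<in> selections M A 1 x" and u: "\<And>k. 1 \<le> k \<Longrightarrow> u k \<in> D"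
    and R: "\<And>k. norm (u k - x) \<le> R" and e: "0 < e"
  shows "\<forall>\<^sub>F k in sequentially. - e \<le> (mean_Y k (u k) - (\<integral>s. \<phi> s \<partial>M)) \<bullet> (u k - x)"
proof -
  have [measurable]: "\<phi> \<in> borel_measurable M" and mem: "AE s in M. \<phi> s \<in> A s x"
    and int: "integrable M \<phi>"
    using M.selections_props[OF \<phi>] by auto
  \<comment> \<open>A positive radius is needed to divide by it below.\<close>
  define R' where "R' = R + 1"
  have R': "0 < R'" "norm (u k - x) \<le> R'" for k
    using R[of k] norm_ge_zero[of "u k - x"] unfolding R'_def by linarith+
  define K where "K = cball x R'"
  let ?N = "\<lambda>y s. norm (least_norm_sel (A s) y)"
  \<comment> \<open>Three tails of size at most \<open>d\<close>, each multiplied by \<open>R'\<close>, must stay below \<open>e / 2\<close>.\<close>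
  define d where "d = e / (8 * R')"
  have d: "0 < d" using e R' by (simp add: d_def)
  have UI: "uniformly_integrable_family M (K \<inter> D) ?N"
    by (rule unif_int) (simp add: K_def)
  then have N_meas: "?N y \<in> borel_measurable M" if "y \<in> K \<inter> D" for y
    using that by (auto simp: uniformly_integrable_family_def)
  have "((\<lambda>a. SUP y \<in> K \<inter> D. \<integral>\<^sup>+ s \<in> {s \<in> space M. a < ?N y s}. ennreal (?N y s) \<partial>M) \<longlongrightarrow> 0) at_top"
    using UI by (simp add: uniformly_integrable_family_def)
  then have "\<forall>\<^sub>F a in at_top. (SUP y \<in> K \<inter> D. \<integral>\<^sup>+ s \<in> {s \<in> space M. a < ?N y s}. ennreal (?N y s) \<partial>M) < ennreal d"
    by (rule order_tendstoD) (use d in simp)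
  then have "\<forall>\<^sub>F a in at_top. 0 \<le> a \<and> (SUP y \<in> K \<inter> D. \<integral>\<^sup>+ s \<in> {s \<in> space M. a < ?N y s}. ennreal (?N y s) \<partial>M) < ennreal d"
    by (intro eventually_conj eventually_ge_at_top)
  then obtain b where b: "0 \<le> b"
    "(SUP y \<in> K \<inter> D. \<integral>\<^sup>+ s \<in> {s \<in> space M. b < ?N y s}. ennreal (?N y s) \<partial>M) < ennreal d"
    using eventually_happens[of _ "at_top :: real filter"] by auto
  define \<alpha> where "\<alpha> y s = (if b < ?N y s then ?N y s else 0)" for y s
  have \<alpha>: "integrable M (\<alpha> y) \<and> (\<integral>s. \<alpha> y s \<partial>M) \<le> d" if y: "y \<in> K \<inter> D" for y
  proof -
    have [measurable]: "?N y \<in> borel_measurable M" by (rule N_meas[OF y])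
    have "(\<integral>\<^sup>+s. ennreal (\<alpha> y s) \<partial>M) = (\<integral>\<^sup>+ s \<in> {s \<in> space M. b < ?N y s}. ennreal (?N y s) \<partial>M)"
      by (intro nn_integral_cong) (auto simp: \<alpha>_def)
    also have "\<dots> \<le> (SUP y \<in> K \<inter> D. \<integral>\<^sup>+ s \<in> {s \<in> space M. b < ?N y s}. ennreal (?N y s) \<partial>M)"
      using y by (rule SUP_upper)
    also have "\<dots> \<le> ennreal d" using b(2) by simp
    finally have le: "(\<integral>\<^sup>+s. ennreal (\<alpha> y s) \<partial>M) \<le> ennreal d" .
    have nonneg: "0 \<le> \<alpha> y s" for s by (simp add: \<alpha>_def)
    have int: "integrable M (\<alpha> y)"
    proof (rule integrableI_bounded)
      show "\<alpha> y \<in> borel_measurable M" unfolding \<alpha>_def[abs_def] by measurable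
      show "(\<integral>\<^sup>+s. ennreal (norm (\<alpha> y s)) \<partial>M) < \<infinity>"
        using le nonneg by (simp add: order_le_less_trans)
    qed
    then show ?thesis
      using le d nn_integral_eq_integral[OF int] nonneg by simp
  qed
  define \<beta> where "\<beta> c s = (if c < norm (\<phi> s) then norm (\<phi> s) else 0)" for c s
  have \<beta>_int: "integrable M (\<beta> c)" for c
  proof (rule Bochner_Integration.integrable_bound[OF int])
    show "\<beta> c \<in> borel_measurable M" unfolding \<beta>_def[abs_def] by measurable
  qed (simp add: \<beta>_def)
  have "(\<lambda>n. \<integral>s. \<beta> (real n) s \<partial>M) \<longlonglongrightarrow> (\<integral>s. 0 \<partial>M)"
  proof (rule integral_dominated_convergence[where w = "\<lambda>s. norm (\<phi> s)"])
    show "AE s in M. (\<lambda>n. \<beta> (real n) s) \<longlonglongrightarrow> 0"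
    proof (rule AE_I2)
      fix s
      obtain m where m: "norm (\<phi> s) \<le> real m" using real_arch_simple by blast
      have "\<beta> (real n) s = 0" if "m \<le> n" for n
        using m that by (simp add: \<beta>_def)
      then show "(\<lambda>n. \<beta> (real n) s) \<longlonglongrightarrow> 0"
        by (intro tendsto_eventually) (auto simp: eventually_sequentially)
    qed
    show "AE s in M. norm (\<beta> (real n) s) \<le> norm (\<phi> s)" for n by (simp add: \<beta>_def)
  qed (use \<beta>_int int in auto)
  then have "\<forall>\<^sub>F n in sequentially. (\<integral>s. \<beta> (real n) s \<partial>M) < d"
    using d by (intro order_tendstoD) auto
  then have "\<forall>\<^sub>F n in sequentially. b \<le> real n \<and> (\<integral>s. \<beta> (real n) s \<partial>M) < d"
    using filterlim_real_sequentially unfolding filterlim_at_top by (auto intro: eventually_conj)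
  then obtain c where c: "b \<le> c" "(\<integral>s. \<beta> c s \<partial>M) < d"
    by (auto dest: eventually_happens)
  have "(\<lambda>k. l k * c\<^sup>2) \<longlonglongrightarrow> 0 * c\<^sup>2" by (intro tendsto_intros step_tendsto_0)
  then have "\<forall>\<^sub>F k in sequentially. l k * c\<^sup>2 < e / 2"
    using e by (intro order_tendstoD) auto
  then show ?thesis
    using eventually_ge_at_top[of 1]
  proof eventually_elim
    fix k :: nat
    assume lk: "l k * c\<^sup>2 < e / 2" and k: "1 \<le> k"
    have uk: "u k \<in> K \<inter> D" using u[OF k] R'(2)[of k] by (simp add: K_def dist_norm norm_minus_commute)
    let ?f = "\<lambda>s. - (l k * c\<^sup>2) - R' * (\<alpha> (u k) s + 2 * \<beta> c s)"
    have int_d: "integrable M (\<lambda>s. Y k s (u k) - \<phi> s)" using integrable_Y(1) int by simp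
    have "(\<integral>s. ?f s \<partial>M) \<le> (\<integral>s. (Y k s (u k) - \<phi> s) \<bullet> (u k - x) \<partial>M)"
    proof (rule integral_mono_AE)
      show "integrable M ?f" using \<alpha>[OF uk] \<beta>_int by simp
      show "integrable M (\<lambda>s. (Y k s (u k) - \<phi> s) \<bullet> (u k - x))"
        using int_d by (rule integrable_inner_left)
      show "AE s in M. ?f s \<le> (Y k s (u k) - \<phi> s) \<bullet> (u k - x)"
        using mem
      proof eventually_elim
        fix s assume s: "\<phi> s \<in> A s x"
        have "u k \<in> dom_op (A s)" using u[OF k] dom by simp
        then have "norm (Y k s (u k)) \<le> ?N (u k) s"
          by (intro yosida_norm_le[OF max_mono step_pos] least_norm_sel_mem[OF max_mono])
        then show "?f s \<le> (Y k s (u k) - \<phi> s) \<bullet> (u k - x)"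
          unfolding \<alpha>_def \<beta>_def by (intro yosida_pairing_lower_bound max_mono step_pos s R' b(1) c(1))
      qed
    qed
    also have "\<dots> = (\<integral>s. Y k s (u k) - \<phi> s \<partial>M) \<bullet> (u k - x)"
      using int_d by (rule integral_inner_left)
    also have "(\<integral>s. Y k s (u k) - \<phi> s \<partial>M) = mean_Y k (u k) - (\<integral>s. \<phi> s \<partial>M)"
      unfolding mean_Y_def using integrable_Y(1) int by simp
    finally have *: "(\<integral>s. ?f s \<partial>M) \<le> (mean_Y k (u k) - (\<integral>s. \<phi> s \<partial>M)) \<bullet> (u k - x)" .
    have "(\<integral>s. ?f s \<partial>M) = - (l k * c\<^sup>2) - R' * ((\<integral>s. \<alpha> (u k) s \<partial>M) + 2 * (\<integral>s. \<beta> c s \<partial>M))"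
      using \<alpha>[OF uk] \<beta>_int by (simp add: M.prob_space)
    moreover have "R' * ((\<integral>s. \<alpha> (u k) s \<partial>M) + 2 * (\<integral>s. \<beta> c s \<partial>M)) \<le> R' * (d + 2 * d)"
      using R' \<alpha>[OF uk] c(2) by (intro mult_left_mono add_mono) auto
    moreover have "R' * (d + 2 * d) \<le> e / 2" using R' e by (simp add: d_def field_simps)
    ultimately show "- e \<le> (mean_Y k (u k) - (\<integral>s. \<phi> s \<partial>M)) \<bullet> (u k - x)"
      using * lk by linarith
  qed
qed

text \<open>
  The sum of the drifts stays bounded while the total weight tends to infinity, so in the average
  only the eventually almost nonnegative difference between drift and \<open>v\<close> is left.
\<close>

lemma AE_weighted_avg_pairing_le:
  assumes v: "v \<in> mean_op M A x"
  shows "AE \<omega> in P. \<forall>e>0. \<forall>\<^sub>F n in sequentially. v \<bullet> (weighted_avg l (\<lambda>k. X k \<omega>) n - x) \<le> e"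
proof -
  obtain \<phi> where \<phi>: "\<phi> \<in> selections M A 1 x" "v = (\<integral>s. \<phi> s \<partial>M)"
    using v by (auto simp: mean_op_def)
  obtain z where z: "z \<in> zer (mean_op M A)" using zer_nonempty by auto
  have W: "filterlim (\<lambda>n. \<Sum>k=1..n. l k) at_top sequentially" by (rule weights_at_top[OF step_sum])
  from AE_drift_bounded_above[of x] AE_dist_to_zero_convergent[OF z] show ?thesis
  proof eventually_elim
    fix \<omega>
    assume "\<exists>C. \<forall>n. (\<Sum>k=1..n. l k * (mean_Y k (X k \<omega>) \<bullet> (X k \<omega> - x))) \<le> C"
      and conv: "convergent (\<lambda>n. norm (X n \<omega> - z))"
    then obtain C where C: "\<And>n. (\<Sum>k=1..n. l k * (mean_Y k (X k \<omega>) \<bullet> (X k \<omega> - x))) \<le> C" by blast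
    obtain B where B: "\<And>n. \<bar>norm (X n \<omega> - z)\<bar> \<le> B"
      using convergent_imp_Bseq[OF conv] by (auto simp: Bseq_def)
    have R: "norm (X n \<omega> - x) \<le> B + norm (z - x)" for n
      using B[of n] norm_triangle_ineq[of "X n \<omega> - z" "z - x"] by simp
    let ?q = "\<lambda>k. (mean_Y k (X k \<omega>) - v) \<bullet> (X k \<omega> - x)"
    show "\<forall>e>0. \<forall>\<^sub>F n in sequentially. v \<bullet> (weighted_avg l (\<lambda>k. X k \<omega>) n - x) \<le> e"
    proof (intro allI impI)
      fix e :: real assume e: "0 < e"
      have "\<forall>\<^sub>F k in sequentially. - (e / 3) \<le> ?q k"
        unfolding \<phi>(2) using e by (intro mean_Y_pairing_eventually_ge[OF \<phi>(1) _ R] X_in_D) auto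
      then have "\<forall>\<^sub>F k in sequentially. - ?q k \<le> e / 3" by (auto elim: eventually_mono)
      from weighted_avg_eventually_le[OF step_pos W this, of "e / 3"]
      have 1: "\<forall>\<^sub>F n in sequentially. weighted_avg l (\<lambda>k. - ?q k) n \<le> e / 3 + e / 3" using e by simp
      have 2: "\<forall>\<^sub>F n in sequentially. max 1 (C / (e / 3)) \<le> (\<Sum>k=1..n. l k)"
        using W unfolding filterlim_at_top by blast
      from 1 2 show "\<forall>\<^sub>F n in sequentially. v \<bullet> (weighted_avg l (\<lambda>k. X k \<omega>) n - x) \<le> e"
      proof eventually_elim
        fix n
        let ?W = "\<Sum>k=1..n. l k"
        assume q: "weighted_avg l (\<lambda>k. - ?q k) n \<le> e / 3 + e / 3" and W: "max 1 (C / (e / 3)) \<le> ?W"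
        have W0: "0 < ?W" and CW: "C \<le> e / 3 * ?W" using W e by (auto simp: field_simps)
        have "?W * (v \<bullet> (weighted_avg l (\<lambda>k. X k \<omega>) n - x)) = v \<bullet> ((\<Sum>k=1..n. l k *\<^sub>R X k \<omega>) - ?W *\<^sub>R x)"
          using W0 by (simp add: weighted_avg_def inner_diff_right right_diff_distrib)
        also have "\<dots> = (\<Sum>k=1..n. l k * (v \<bullet> (X k \<omega> - x)))"
          by (simp add: inner_diff_right inner_sum_right right_diff_distrib sum_subtractf sum_distrib_right)
        also have "\<dots> = (\<Sum>k=1..n. l k * (mean_Y k (X k \<omega>) \<bullet> (X k \<omega> - x))) + (\<Sum>k=1..n. l k * - ?q k)"
          unfolding sum.distrib[symmetric]
          by (intro sum.cong refl) (simp add: inner_diff_left right_diff_distrib)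
        also have "(\<Sum>k=1..n. l k * - ?q k) = ?W * weighted_avg l (\<lambda>k. - ?q k) n"
          using W0 by (simp add: weighted_avg_def)
        also have "\<dots> \<le> ?W * (e / 3 + e / 3)" using W0 q by (intro mult_left_mono) auto
        finally have "?W * (v \<bullet> (weighted_avg l (\<lambda>k. X k \<omega>) n - x)) \<le> e / 3 * ?W + ?W * (e / 3 + e / 3)"
          using C[of n] CW by linarith
        also have "\<dots> = ?W * e" by (simp add: algebra_simps)
        finally show "v \<bullet> (weighted_avg l (\<lambda>k. X k \<omega>) n - x) \<le> e" using W0 by simp
      qed
    qed
  qed
qed

text \<open>
  Both families of almost sure statements, over the zeros and over the graph, are uncountable. They
  are taken on countable dense subsets and extended by continuity on each path.
\<close>

theorem AE_weighted_avg_weakly_converges: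
  "AE \<omega> in P. \<exists>z \<in> zer (mean_op M A). weakly_converges (weighted_avg l (\<lambda>n. X n \<omega>)) z"
proof -
  let ?Z = "zer (mean_op M A)" and ?G = "graph_op (mean_op M A)"
  obtain Z0 where Z0: "countable Z0" "Z0 \<subseteq> ?Z" "?Z \<subseteq> closure Z0" by (rule separable)
  obtain G0 where G0: "countable G0" "G0 \<subseteq> ?G" "?G \<subseteq> closure G0" by (rule separable)
  have "AE \<omega> in P. \<forall>z\<in>Z0. convergent (\<lambda>n. norm (X n \<omega> - z))"
    using Z0 by (intro AE_ball_countable[THEN iffD2] ballI AE_dist_to_zero_convergent) auto
  moreover have "AE \<omega> in P. \<forall>g\<in>G0. \<forall>e>0. \<forall>\<^sub>F n in sequentially.
      snd g \<bullet> (weighted_avg l (\<lambda>k. X k \<omega>) n - fst g) \<le> e"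
    using G0 by (intro AE_ball_countable[THEN iffD2] ballI AE_weighted_avg_pairing_le)
      (auto simp: graph_op_def)
  ultimately show ?thesis
  proof eventually_elim
    fix \<omega>
    assume conv0: "\<forall>z\<in>Z0. convergent (\<lambda>n. norm (X n \<omega> - z))"
      and le: "\<forall>g\<in>G0. \<forall>e>0. \<forall>\<^sub>F n in sequentially. snd g \<bullet> (weighted_avg l (\<lambda>k. X k \<omega>) n - fst g) \<le> e"
    let ?a = "weighted_avg l (\<lambda>k. X k \<omega>)"
    show "\<exists>z \<in> ?Z. weakly_converges ?a z"
    proof (rule weighted_avg_weakly_converges[OF step_pos weights_at_top[OF step_sum] zer_nonempty])
      fix z assume z: "z \<in> ?Z"
      have "Cauchy (\<lambda>n. norm (X n \<omega> - z))"
      proof (rule metric_CauchyI)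
        fix e :: real assume e: "0 < e"
        obtain z' where z': "z' \<in> Z0" "dist z' z < e / 3"
          using Z0(3) z closure_approachable[of z Z0] e by (meson subsetD zero_less_divide_iff zero_less_numeral)
        have near: "\<bar>norm (X n \<omega> - z) - norm (X n \<omega> - z')\<bar> < e / 3" for n
          using norm_triangle_ineq3[of "X n \<omega> - z" "X n \<omega> - z'"] z'(2) by (simp add: dist_norm)
        have "Cauchy (\<lambda>n. norm (X n \<omega> - z'))" using conv0 z'(1) by (simp add: convergent_Cauchy)
        then obtain N where N: "\<And>m n. N \<le> m \<Longrightarrow> N \<le> n \<Longrightarrow>
            dist (norm (X m \<omega> - z')) (norm (X n \<omega> - z')) < e / 3"
          using metric_CauchyD[of _ "e / 3"] e by (metis zero_less_divide_iff zero_less_numeral)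
        show "\<exists>N. \<forall>m\<ge>N. \<forall>n\<ge>N. dist (norm (X m \<omega> - z)) (norm (X n \<omega> - z)) < e"
        proof (intro exI allI impI)
          fix m n assume "N \<le> m" "N \<le> n"
          from N[OF this] near[of m] near[of n]
          show "dist (norm (X m \<omega> - z)) (norm (X n \<omega> - z)) < e"
            unfolding dist_real_def by linarith
        qed
      qed
      then show "convergent (\<lambda>n. norm (X n \<omega> - z))" by (simp add: real_Cauchy_convergent)
    next
      fix r :: "nat \<Rightarrow> nat" and p
      assume r: "strict_mono r" and lim: "\<And>h. (\<lambda>n. ?a (r n) \<bullet> h) \<longlonglongrightarrow> p \<bullet> h"
      have "snd g \<bullet> (p - fst g) \<le> 0" if g: "g \<in> G0" for g
      proof (rule field_le_epsilon)
        fix e :: real assume "0 < e"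
        then have "\<forall>\<^sub>F n in sequentially. snd g \<bullet> (?a n - fst g) \<le> e" using le g by blast
        then have ev: "\<forall>\<^sub>F n in sequentially. snd g \<bullet> (?a (r n) - fst g) \<le> e"
          using filterlim_subseq[OF r] by (rule eventually_compose_filterlim)
        have "(\<lambda>n. ?a (r n) \<bullet> snd g - snd g \<bullet> fst g) \<longlonglongrightarrow> p \<bullet> snd g - snd g \<bullet> fst g"
          by (intro tendsto_diff lim tendsto_const)
        then have "(\<lambda>n. snd g \<bullet> (?a (r n) - fst g)) \<longlonglongrightarrow> snd g \<bullet> (p - fst g)"
          by (simp add: inner_diff_right inner_commute)
        then show "snd g \<bullet> (p - fst g) \<le> 0 + e"
          using ev by (simp add: tendsto_upperbound)
      qed
      then have "G0 \<subseteq> {g. snd g \<bullet> (p - fst g) \<le> 0}" by auto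
      moreover have "closed {g :: 'h \<times> 'h. snd g \<bullet> (p - fst g) \<le> 0}"
        by (intro closed_Collect_le continuous_intros)
      ultimately have G: "?G \<subseteq> {g. snd g \<bullet> (p - fst g) \<le> 0}"
        using G0(3) closure_minimal by blast
      have "0 \<in> mean_op M A p"
      proof (rule maximal_monotoneD_max[OF mean_max])
        fix x v assume "v \<in> mean_op M A x"
        then have "v \<bullet> (p - x) \<le> 0" using G by (auto simp: graph_op_def)
        then show "0 \<le> (x - p) \<bullet> (v - 0)" by (simp add: inner_diff_left inner_diff_right inner_commute)
      qed
      then show "p \<in> ?Z" by (simp add: zer_def)
    qed
  qed
qed

end

section \<open>Almost sure hypotheses\<close>

text \<open>
  The almost sure hypotheses are upgraded to sure ones by replacing \<open>A s\<close>, for \<open>s\<close> in a null set,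
  by the operator at one fixed good point. This changes none of the integrals, and it changes the
  iterates only on the null event that some draw falls into the exceptional set.
\<close>

theorem corollary1:
  fixes M :: "'e measure"
    and P :: "'w measure"
    and A :: "'e \<Rightarrow> 'h \<Rightarrow> 'h::{real_inner, banach, second_countable_topology} set"
    and l :: "nat \<Rightarrow> real"
    and \<xi> :: "nat \<Rightarrow> 'w \<Rightarrow> 'e"
    and x0 :: 'h
  assumes "prob_space M" and "complete_measure M"
    and "prob_space P"
    and max_mono: "AE s in M. maximal_monotone (A s)"
    and resolvent_meas:
      "\<And>r x. 0 < r \<Longrightarrow> (\<lambda>s. resolvent r (A s) x) \<in> borel_measurable M"
    and step_pos: "\<And>n. 0 < l n"
    and step_sum: "filterlim (\<lambda>n. \<Sum>k<n. l k) at_top sequentially"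
    and step_sq: "summable (\<lambda>n. (l n)\<^sup>2)"
    and xi_meas: "\<And>n. 1 \<le> n \<Longrightarrow> \<xi> n \<in> measurable P M"
    and xi_distr: "\<And>n. 1 \<le> n \<Longrightarrow> distr P M (\<xi> n) = M"
    and xi_indep: "prob_space.indep_vars P (\<lambda>_. M) \<xi> {1..}"
    and mean_max: "maximal_monotone (mean_op M A)"
    and zer_nonempty: "zer (mean_op M A) \<noteq> {}"
    and zer_sub: "zer (mean_op M A) \<subseteq> zer_sel M A 2"
    and unif_int: "\<And>K :: 'h set. bounded K \<Longrightarrow>
      uniformly_integrable_family M (K \<inter> ess_dom M A) (\<lambda>x s. norm (least_norm_sel (A s) x))"
    and dom_const: "\<exists>D. AE s in M. dom_op (A s) = D"
  shows "AE \<omega> in P. \<exists>z \<in> zer (mean_op M A).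
    weakly_converges (weighted_avg l (\<lambda>n. prox_seq A l \<xi> x0 n \<omega>)) z"
proof -
  interpret M: prob_space M by fact
  interpret P: prob_space P by fact
  obtain D where "AE s in M. dom_op (A s) = D" using dom_const by blast
  with max_mono have "AE s in M. maximal_monotone (A s) \<and> dom_op (A s) = D" by eventually_elim simp
  then obtain N where N: "{s \<in> space M. \<not> (maximal_monotone (A s) \<and> dom_op (A s) = D)} \<subseteq> N"
      "N \<in> sets M" "emeasure M N = 0"
    by (rule AE_E)
  define E where "E = space M - N"
  have E_sets [measurable]: "E \<in> sets M" using N by (simp add: E_def)
  have good: "maximal_monotone (A s)" "dom_op (A s) = D" if "s \<in> E" for s
    using that N(1) by (auto simp: E_def)
  have AE_E: "AE s in M. s \<in> E"
    using N by (intro AE_I'[of N]) (auto simp: E_def null_sets_def)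
  have "E \<noteq> {}" using AE_E M.AE_False by auto
  then obtain s0 where s0: "s0 \<in> E" by auto
  define A' where "A' s = (if s \<in> E then A s else A s0)" for s
  have A': "maximal_monotone (A' s)" "dom_op (A' s) = D" for s
    using good s0 by (auto simp: A'_def)
  have AE_eq: "AE s in M. A' s = A s" using AE_E by eventually_elim (simp add: A'_def)
  have selections: "selections M A' p x = selections M A p x" for p x
  proof -
    have "(AE s in M. \<phi> s \<in> A' s x) \<longleftrightarrow> (AE s in M. \<phi> s \<in> A s x)" for \<phi>
    proof
      assume "AE s in M. \<phi> s \<in> A' s x"
      with AE_eq show "AE s in M. \<phi> s \<in> A s x" by eventually_elim simp
    next
      assume "AE s in M. \<phi> s \<in> A s x"
      with AE_eq show "AE s in M. \<phi> s \<in> A' s x" by eventually_elim simp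
    qed
    then show ?thesis by (simp add: selections_def)
  qed
  have mean: "mean_op M A' = mean_op M A"
    by (simp add: mean_op_def fun_eq_iff selections)
  have zsel: "zer_sel M A' p = zer_sel M A p" for p by (simp add: zer_sel_def selections)
  have ess: "ess_dom M A = D"
  proof -
    have "(AE s in M. x \<in> dom_op (A s)) \<longleftrightarrow> (AE s in M. x \<in> D)" for x
    proof
      assume "AE s in M. x \<in> dom_op (A s)"
      with AE_E show "AE s in M. x \<in> D" by eventually_elim (simp add: good)
    next
      assume "AE s in M. x \<in> D"
      with AE_E show "AE s in M. x \<in> dom_op (A s)" by eventually_elim (simp add: good)
    qed
    then show ?thesis by (simp add: ess_dom_def)
  qed
  interpret stochastic_prox P M \<xi> A' l x0 D
  proof
    show "\<xi> n \<in> measurable P M" "distr P M (\<xi> n) = M" if "1 \<le> n" for n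
      using that xi_meas xi_distr by auto
    show "(\<lambda>s. resolvent r (A' s) x) \<in> borel_measurable M" if "0 < r" for r x
    proof -
      have "(\<lambda>s. if s \<in> E then resolvent r (A s) x else resolvent r (A s0) x) \<in> borel_measurable M"
        using resolvent_meas[OF that] by measurable
      moreover have "resolvent r (A' s) x = (if s \<in> E then resolvent r (A s) x else resolvent r (A s0) x)" for s
        by (simp add: A'_def)
      ultimately show ?thesis by simp
    qed
    show "uniformly_integrable_family M (K \<inter> D) (\<lambda>x s. norm (least_norm_sel (A' s) x))"
      if K: "bounded K" for K :: "'h set"
    proof -
      let ?f = "\<lambda>x s. norm (least_norm_sel (A s) x)" and ?f' = "\<lambda>x s. norm (least_norm_sel (A' s) x)"
      have UI: "uniformly_integrable_family M (K \<inter> D) ?f" using unif_int[OF K] by (simp add: ess)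
      have "?f' x \<in> borel_measurable M" if "x \<in> K \<inter> D" for x
      proof -
        have "?f x \<in> borel_measurable M"
          using UI that unfolding uniformly_integrable_family_def by blast
        then have "(\<lambda>s. if s \<in> E then ?f x s else ?f x s0) \<in> borel_measurable M" by measurable
        moreover have "?f' x s = (if s \<in> E then ?f x s else ?f x s0)" for s
          by (simp add: A'_def)
        ultimately show ?thesis by simp
      qed
      moreover have "(\<integral>\<^sup>+ s \<in> {s \<in> space M. a < ?f' x s}. ennreal (?f' x s) \<partial>M)
          = (\<integral>\<^sup>+ s \<in> {s \<in> space M. a < ?f x s}. ennreal (?f x s) \<partial>M)" for a x
        using AE_E by (intro nn_integral_cong_AE) (auto elim!: eventually_mono simp: A'_def indicator_def)
      ultimately show ?thesis
        using UI unfolding uniformly_integrable_family_def by simp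
    qed
  qed (use A' step_pos step_sum step_sq mean_max zer_nonempty zer_sub xi_indep in \<open>simp_all add: mean zsel\<close>)
  have "AE \<omega> in P. \<forall>n. \<xi> (Suc n) \<omega> \<in> E" by (rule AE_xi[OF AE_E])
  with AE_weighted_avg_weakly_converges show ?thesis
  proof eventually_elim
    fix \<omega>
    assume *: "\<exists>z \<in> zer (mean_op M A'). weakly_converges (weighted_avg l (\<lambda>n. prox_seq A' l \<xi> x0 n \<omega>)) z"
      and E: "\<forall>n. \<xi> (Suc n) \<omega> \<in> E"
    have "prox_seq A' l \<xi> x0 n \<omega> = prox_seq A l \<xi> x0 n \<omega>" for n
      by (induction n) (use E in \<open>simp_all add: A'_def\<close>)
    then show "\<exists>z \<in> zer (mean_op M A). weakly_converges (weighted_avg l (\<lambda>n. prox_seq A l \<xi> x0 n \<omega>)) z"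
      using * by (simp add: mean)
  qed
qed

end
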